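(* Let $p\ge1$, $J=\{1,\dots,p\}$, and let $W$ be the standard $p$-parameter Gaussian Wiener measure on $[0,1]^p$. Then there exist mutually independent centred Gaussian zm-measures $b_H$ on $[0,1]^H$, one for each subset $H\subset J$ (Brownian pillows), defined on the same probability space as $W$, such that for all Borel sets $A_1,\dots,A_p\subset[0,1]$, almost surely, $$W\left(\prod_{j=1}^pA_j\right)=\sum_{H\subset J}\left(\prod_{j\in J\setminus H}\lambda(A_j)\right)b_H\left(\prod_{j\in H}A_j\right),$$ where $\lambda$ is Lebesgue measure on $[0,1]$, and such that each $b_H$ has covariance $$\mathbf{E}\left[b_H\left(\prod_{j\in H}A_j\right)b_H\left(\prod_{j\in H}B_j\right)\right]=\prod_{j\in H}\bigl(\lambda(A_j\cap B_j)-\lambda(A_j)\lambda(B_j)\bigr)$$ for all Borel sets $A_j,B_j\subset[0,1]$, $j\in H$.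
   Context: A centred Gaussian (random) measure $M$ on $[0,1]^H$ is a jointly Gaussian family of centred real random variables $M(A)$, indexed by the Borel sets $A\subset[0,1]^H$, on one probability space, that is countably additive in $L^2$: $M\left(\bigcup_iA_i\right)=\sum_iM(A_i)$, with convergence in $L^2$, for disjoint Borel sets $A_i$. The standard $p$-parameter Wiener measure $W$ on $[0,1]^p$ is the centred Gaussian measure with covariance $\mathbf{E}\left[W\left(\prod_{j=1}^pA_j\right)W\left(\prod_{j=1}^pB_j\right)\right]=\prod_{j=1}^p\lambda(A_j\cap B_j)$ for Borel sets $A_j,B_j\subset[0,1]$. A centred Gaussian measure $M_H$ on $[0,1]^H$ is a zm-measure (zero-marginals measure) when $M_H\left(\prod_{j\in H}A_j\right)=0$ almost surely whenever $A_j\subset[0,1]$ is Borel for all $j\in H$ and $A_j=[0,1]$ for at least one $j\in H$. The subsets $H\subset J$ include $\emptyset$ and $J$. For $H=\emptyset$, $[0,1]^\emptyset$ is a one-point space, the empty product of sets is that space, empty products of numbers equal $1$, and $b_\emptyset$ is identified with a single centred Gaussian random variable (of variance $1$). Mutual independence of the $b_H$ means that the families $\{b_H(A)\}_A$, $H\subset J$, are mutually independent. *)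

theory Defs
  imports "HOL-Probability.Probability"
begin

definition unit_cube :: "'i set \<Rightarrow> ('i \<Rightarrow> real) measure" where
  "unit_cube H = (\<Pi>\<^sub>M j\<in>H. restrict_space borel {0..1})"

text \<open>
  Points of \<open>[0,1]\<^sup>H\<close> are extensional functions, so \<open>[0,1]\<^sup>\<emptyset>\<close> has exactly one point.  Only the
  \<open>\<sigma>\<close>-algebra of \<^const>\<open>unit_cube\<close> is used; the next lemma says that it is the Borel one.
\<close>

lemma sets_unit_cube_eq_borel:
  fixes H :: "'i::countable set"
  shows "sets (unit_cube H) = {A \<in> sets borel. A \<subseteq> (\<Pi>\<^sub>E j\<in>H. {0..1})}"
proof (intro equalityI subsetI)
  fix A :: "('i \<Rightarrow> real) set"
  assume A: "A \<in> {A \<in> sets borel. A \<subseteq> (\<Pi>\<^sub>E j\<in>H. {0..1})}"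
  have "(\<lambda>f. f) \<in> unit_cube H \<rightarrow>\<^sub>M (\<Pi>\<^sub>M j\<in>UNIV. (borel :: real measure))"
  proof (rule measurable_PiM_single')
    fix j :: 'i
    show "(\<lambda>f. f j) \<in> borel_measurable (unit_cube H)"
    proof (cases "j \<in> H")
      case True
      then have "(\<lambda>f. f j) \<in> unit_cube H \<rightarrow>\<^sub>M restrict_space borel {0..1}"
        unfolding unit_cube_def by (rule measurable_component_singleton)
      then show ?thesis by (auto simp: measurable_restrict_space2_iff)
    next
      case False
      have "f j = undefined" if "f \<in> space (unit_cube H)" for f
        using that False by (auto simp: unit_cube_def space_PiM PiE_def extensional_def)
      then show ?thesis by (subst measurable_cong[where g = "\<lambda>_. undefined"]) auto
    qed
  qed auto
  then have "(\<lambda>f. f) \<in> unit_cube H \<rightarrow>\<^sub>M borel"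
    using measurable_cong_sets[OF refl sets_PiM_equal_borel] by blast
  from measurable_sets[OF this, of A] show "A \<in> sets (unit_cube H)"
    using A by (simp add: unit_cube_def space_PiM Int_absorb2 space_restrict_space)
next
  fix A :: "('i \<Rightarrow> real) set"
  assume A: "A \<in> sets (unit_cube H)"
  let ?C = "\<Pi>\<^sub>E j\<in>H. {0..1::real}"
  have C: "space (unit_cube H) = ?C"
    by (simp add: unit_cube_def space_PiM space_restrict_space)
  have comp: "(\<lambda>f::'i \<Rightarrow> real. f j) \<in> borel_measurable borel" for j
    by (intro borel_measurable_continuous_onI) auto
  have "?C = (\<Inter>j. {f. f j \<in> (if j \<in> H then {0..1} else {undefined})})"
    by (auto simp: PiE_def extensional_def Pi_def split: if_splits)
  also have "\<dots> \<in> sets borel"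
  proof (rule sets.countable_INT'')
    fix j :: 'i
    have "(\<lambda>f::'i \<Rightarrow> real. f j) -` (if j \<in> H then {0..1} else {undefined}) \<inter> space borel \<in> sets borel"
      by (rule measurable_sets[OF comp]) auto
    then show "{f::'i \<Rightarrow> real. f j \<in> (if j \<in> H then {0..1} else {undefined})} \<in> sets borel"
      by (simp add: vimage_def)
  qed auto
  finally have Cb: "?C \<in> sets borel" .
  have "(\<lambda>f. f) \<in> restrict_space borel ?C \<rightarrow>\<^sub>M unit_cube H"
    unfolding unit_cube_def
  proof (rule measurable_PiM_single')
    fix j assume "j \<in> H"
    then show "(\<lambda>f. f j) \<in> restrict_space borel ?C \<rightarrow>\<^sub>M restrict_space borel {0..1}"
      by (intro measurable_restrict_space2 measurable_restrict_space1 comp)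
         (auto simp: space_restrict_space)
  qed (auto simp: space_restrict_space)
  from measurable_sets[OF this A] have "A \<in> sets (restrict_space borel ?C)"
    using sets.sets_into_space[OF A] by (simp add: C Int_absorb2 space_restrict_space)
  then show "A \<in> {A \<in> sets borel. A \<subseteq> ?C}"
    using Cb by (simp add: sets_restrict_space_iff)
qed

text \<open>The almost surely vanishing variable counts as Gaussian (variance \<open>0\<close>).\<close>

definition centred_gaussian :: "'w measure \<Rightarrow> ('w \<Rightarrow> real) \<Rightarrow> bool" where
  "centred_gaussian M X \<longleftrightarrow>
     X \<in> borel_measurable M \<and>
     ((AE \<omega> in M. X \<omega> = 0) \<or> (\<exists>\<sigma>>0. distributed M lborel X (normal_density 0 \<sigma>)))"

definition jointly_centred_gaussian :: "'w measure \<Rightarrow> 'k set \<Rightarrow> ('k \<Rightarrow> 'w \<Rightarrow> real) \<Rightarrow> bool" where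
  "jointly_centred_gaussian M K X \<longleftrightarrow>
     (\<forall>F c. finite F \<and> F \<subseteq> K \<longrightarrow> centred_gaussian M (\<lambda>\<omega>. \<Sum>k\<in>F. c k * X k \<omega>))"

definition gaussian_measure ::
  "'w measure \<Rightarrow> 'i set \<Rightarrow> (('i \<Rightarrow> real) set \<Rightarrow> 'w \<Rightarrow> real) \<Rightarrow> bool" where
  "gaussian_measure M H m \<longleftrightarrow>
     jointly_centred_gaussian M (sets (unit_cube H)) m \<and>
     (\<forall>A. range A \<subseteq> sets (unit_cube H) \<and> disjoint_family A \<longrightarrow>
        (\<lambda>n. LINT \<omega>|M. (m (\<Union>i. A i) \<omega> - (\<Sum>i<n::nat. m (A i) \<omega>))\<^sup>2) \<longlonglongrightarrow> 0)"

definition borel_box :: "'i set \<Rightarrow> ('i \<Rightarrow> real set) \<Rightarrow> bool" where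
  "borel_box H A \<longleftrightarrow> (\<forall>j\<in>H. A j \<in> sets borel \<and> A j \<subseteq> {0..1})"

definition wiener_measure ::
  "'w measure \<Rightarrow> nat \<Rightarrow> ((nat \<Rightarrow> real) set \<Rightarrow> 'w \<Rightarrow> real) \<Rightarrow> bool" where
  "wiener_measure M p W \<longleftrightarrow>
     gaussian_measure M {1..p} W \<and>
     (\<forall>A B. borel_box {1..p} A \<and> borel_box {1..p} B \<longrightarrow>
        (LINT \<omega>|M. W (PiE {1..p} A) \<omega> * W (PiE {1..p} B) \<omega>)
          = (\<Prod>j\<in>{1..p}. measure lborel (A j \<inter> B j)))"

definition zm_measure ::
  "'w measure \<Rightarrow> 'i set \<Rightarrow> (('i \<Rightarrow> real) set \<Rightarrow> 'w \<Rightarrow> real) \<Rightarrow> bool" where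
  "zm_measure M H m \<longleftrightarrow>
     gaussian_measure M H m \<and>
     (\<forall>A. borel_box H A \<and> (\<exists>j\<in>H. A j = {0..1}) \<longrightarrow> (AE \<omega> in M. m (PiE H A) \<omega> = 0))"

text \<open>
  Independence of whole families: the family \<open>(b H A)\<^sub>A\<close> is read as one random element of the
  product space \<open>\<real>\<^bsup>sets (unit_cube H)\<^esup>\<close>, whose generated \<open>\<sigma>\<close>-algebra is that generated by all
  the variables \<open>b H A\<close>.
\<close>

definition indep_measures ::
  "'w measure \<Rightarrow> 'i set set \<Rightarrow> ('i set \<Rightarrow> ('i \<Rightarrow> real) set \<Rightarrow> 'w \<Rightarrow> real) \<Rightarrow> bool" where
  "indep_measures M \<H> b \<longleftrightarrow>
     prob_space.indep_vars M
       (\<lambda>H. \<Pi>\<^sub>M A\<in>sets (unit_cube H). (borel :: real measure))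
       (\<lambda>H \<omega>. \<lambda>A\<in>sets (unit_cube H). b H A \<omega>) \<H>"

end

theory Submission imports Defs begin

text \<open>
  Write \<open>C\<close> for Lebesgue measure on \<open>[0,1]\<^sup>J\<close>.  The white noise \<open>W\<close> extends to the Wiener integral
  \<open>f \<mapsto> \<integral>f dW\<close>, a linear isometry of \<open>L\<^sup>2(C)\<close> onto a space of centred Gaussian variables.  For
  \<open>H \<subseteq> J\<close> the pillow \<open>b\<^sub>H(A)\<close> is the integral of the function
  \<open>f\<^sub>H\<^sub>,\<^sub>A(x) = \<Sum>\<^bsub>G\<subseteq>H\<^esub> (-1)\<^bsup>|H-G|\<^esup> C{y. (x on G, y on H-G) \<in> A}\<close>,
  that is, of the indicator of \<open>A\<close> integrated against \<open>\<Otimes>\<^bsub>j\<in>H\<^esub> (\<delta>\<^bsub>x\<^sub>j\<^esub> - \<lambda>)\<close>.  It is bounded, and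
  countably additive in \<open>A\<close>, and on a box it is the product of the centred indicators
  \<open>1\<^bsub>A\<^sub>j\<^esub>(x\<^sub>j) - \<lambda>(A\<^sub>j)\<close>, \<open>j \<in> H\<close>.

  Apart from independence, everything follows from the isometry.  Expanding
  \<open>\<Prod>\<^bsub>j\<in>J\<^esub> 1\<^bsub>A\<^sub>j\<^esub> = \<Prod>\<^bsub>j\<in>J\<^esub> ((1\<^bsub>A\<^sub>j\<^esub> - \<lambda>(A\<^sub>j)) + \<lambda>(A\<^sub>j))\<close> gives the decomposition of \<open>W\<close>; by Fubini
  the inner product of two such functions on boxes is the asserted product when the index sets
  agree and \<open>0\<close> otherwise, since a centred indicator integrates to \<open>0\<close>; a factor \<open>A\<^sub>j = [0,1]\<close> makes
  the integrand vanish; and countable additivity in \<open>L\<^sup>2\<close> is dominated convergence for the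
  integrands.  Orthogonality of the families for distinct index sets extends from boxes to all Borel
  sets by a \<open>\<pi>\<close>-\<open>\<lambda>\<close> argument (\<open>pillow_fun_orthogonal\<close>), which also extends the covariance of \<open>W\<close>
  (\<open>wiener_white_noise\<close>).

  It remains that orthogonal families inside one space of centred Gaussian variables are
  independent (\<open>orthogonal_families_indep\<close>).  Only linear combinations are known to be Gaussian, so
  joint laws are reached through Fourier transforms: if \<open>E[V e\<^bsup>isX\<^esup>] = 0\<close> for all \<open>s\<close>, then
  \<open>E[V; X \<in> A] = 0\<close> for all Borel \<open>A\<close> (\<open>fourier_zero\<close>, from Levy's uniqueness theorem in
  dimension one), and exponentials are traded for indicators one variable at a time.
\<close>

section \<open>Square-integrable functions\<close>

text \<open>Real-valued square-integrable functions.  They are kept as functions, without passing to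
  classes modulo null sets; the inner product and the squared norm are plain integrals.\<close>

definition sq_int :: "'a measure \<Rightarrow> ('a \<Rightarrow> real) \<Rightarrow> bool" where
  "sq_int M f \<longleftrightarrow> f \<in> borel_measurable M \<and> integrable M (\<lambda>x. (f x)\<^sup>2)"

abbreviation (input) inner_L2 :: "'a measure \<Rightarrow> ('a \<Rightarrow> real) \<Rightarrow> ('a \<Rightarrow> real) \<Rightarrow> real" where
  "inner_L2 M f g \<equiv> (LINT x|M. f x * g x)"

abbreviation (input) sqnorm :: "'a measure \<Rightarrow> ('a \<Rightarrow> real) \<Rightarrow> real" where
  "sqnorm M f \<equiv> (LINT x|M. (f x)\<^sup>2)"

lemma sq_intD [dest]:
  assumes "sq_int M f"
  shows "f \<in> borel_measurable M" "integrable M (\<lambda>x. (f x)\<^sup>2)"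
  using assms by (auto simp: sq_int_def)

lemma sq_int_mult:
  assumes "sq_int M f" "sq_int M g"
  shows "integrable M (\<lambda>x. f x * g x)"
proof (rule Bochner_Integration.integrable_bound)
  note [measurable] = sq_intD(1)[OF assms(1)] sq_intD(1)[OF assms(2)]
  show "integrable M (\<lambda>x. (f x)\<^sup>2 + (g x)\<^sup>2)"
    using assms by (auto intro!: Bochner_Integration.integrable_add)
  show "(\<lambda>x. f x * g x) \<in> borel_measurable M" by measurable
  have "\<bar>a * b\<bar> \<le> a\<^sup>2 + b\<^sup>2" for a b :: real
  proof -
    have "2 * (\<bar>a\<bar> * \<bar>b\<bar>) \<le> \<bar>a\<bar>\<^sup>2 + \<bar>b\<bar>\<^sup>2" using sum_squares_bound[of "\<bar>a\<bar>" "\<bar>b\<bar>"] by simp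
    moreover have "0 \<le> \<bar>a\<bar> * \<bar>b\<bar>" by (rule mult_nonneg_nonneg) auto
    ultimately show ?thesis unfolding abs_mult power2_abs by linarith
  qed
  then show "AE x in M. norm (f x * g x) \<le> norm ((f x)\<^sup>2 + (g x)\<^sup>2)" by simp
qed

lemma sq_int_add [intro]:
  assumes "sq_int M f" "sq_int M g"
  shows "sq_int M (\<lambda>x. f x + g x)"
proof -
  have "integrable M (\<lambda>x. (f x)\<^sup>2 + (g x)\<^sup>2 + 2 * (f x * g x))"
    using assms sq_int_mult[OF assms] by (auto intro!: Bochner_Integration.integrable_add)
  then show ?thesis using assms unfolding sq_int_def by (auto simp: power2_sum mult.assoc)
qed

lemma sq_int_scale [intro]: "sq_int M f \<Longrightarrow> sq_int M (\<lambda>x. c * f x)"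
  by (auto simp: sq_int_def power_mult_distrib)

lemma sq_int_diff [intro]:
  "sq_int M f \<Longrightarrow> sq_int M g \<Longrightarrow> sq_int M (\<lambda>x. f x - g x)"
  using sq_int_add[of M f "\<lambda>x. (-1) * g x"] sq_int_scale[of M g "-1"] by simp

lemma sq_int_sum [intro]: "(\<And>i. i \<in> I \<Longrightarrow> sq_int M (f i)) \<Longrightarrow> sq_int M (\<lambda>x. \<Sum>i\<in>I. f i x)"
  by (induction I rule: infinite_finite_induct) (auto simp: sq_int_def[of M "\<lambda>x. 0"])

lemma (in finite_measure) sq_int_bounded:
  assumes "f \<in> borel_measurable M" "\<And>x. x \<in> space M \<Longrightarrow> \<bar>f x\<bar> \<le> B"
  shows "sq_int M f"
  unfolding sq_int_def
proof
  show "integrable M (\<lambda>x. (f x)\<^sup>2)"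
  proof (rule integrable_const_bound)
    show "AE x in M. norm ((f x)\<^sup>2) \<le> B\<^sup>2"
    proof (intro AE_I2)
      fix x assume "x \<in> space M"
      then have "\<bar>f x\<bar>\<^sup>2 \<le> B\<^sup>2" by (intro power_mono assms(2)) auto
      then show "norm ((f x)\<^sup>2) \<le> B\<^sup>2" by simp
    qed
  qed (use assms in measurable)
qed fact

lemma sqnorm_add:
  assumes "sq_int M f" "sq_int M g"
  shows "sqnorm M (\<lambda>x. f x + g x) = sqnorm M f + 2 * inner_L2 M f g + sqnorm M g"
proof -
  have "sqnorm M (\<lambda>x. f x + g x) = (LINT x|M. (f x)\<^sup>2 + (2 * (f x * g x) + (g x)\<^sup>2))"
    by (intro Bochner_Integration.integral_cong refl) (simp add: power2_sum)
  also have "\<dots> = sqnorm M f + (LINT x|M. 2 * (f x * g x) + (g x)\<^sup>2)"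
    using assms sq_int_mult[OF assms] by (intro Bochner_Integration.integral_add) auto
  also have "(LINT x|M. 2 * (f x * g x) + (g x)\<^sup>2) = (LINT x|M. 2 * (f x * g x)) + sqnorm M g"
    using assms sq_int_mult[OF assms] by (intro Bochner_Integration.integral_add) auto
  finally show ?thesis by simp
qed

lemma sqnorm_scale: "sqnorm M (\<lambda>x. c * f x) = c\<^sup>2 * sqnorm M f"
  by (simp add: power_mult_distrib)

lemma sqnorm_nonneg: "0 \<le> sqnorm M f"
  by (intro integral_nonneg_AE) auto

lemma inner_L2_add:
  assumes "sq_int M f" "sq_int M g" "sq_int M h"
  shows "inner_L2 M (\<lambda>x. f x + g x) h = inner_L2 M f h + inner_L2 M g h"
  using sq_int_mult[of M f h] sq_int_mult[of M g h] assms by (simp add: distrib_right)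

lemma inner_L2_diff:
  assumes "sq_int M f" "sq_int M g" "sq_int M h"
  shows "inner_L2 M (\<lambda>x. f x - g x) h = inner_L2 M f h - inner_L2 M g h"
  using sq_int_mult[of M f h] sq_int_mult[of M g h] assms by (simp add: left_diff_distrib)

lemma inner_L2_scale: "inner_L2 M (\<lambda>x. c * f x) g = c * inner_L2 M f g"
  by (simp add: mult.assoc)

lemma inner_L2_sum:
  assumes "\<And>i. i \<in> I \<Longrightarrow> sq_int M (f i)" "sq_int M g"
  shows "inner_L2 M (\<lambda>x. \<Sum>i\<in>I. f i x) g = (\<Sum>i\<in>I. inner_L2 M (f i) g)"
  using sq_int_mult[OF assms(1) assms(2)]
  by (simp add: sum_distrib_right)

lemma sqnorm_add_le:
  assumes "sq_int M f" "sq_int M g"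
  shows "sqnorm M (\<lambda>x. f x + g x) \<le> 2 * sqnorm M f + 2 * sqnorm M g"
proof -
  have "sqnorm M (\<lambda>x. f x + g x) \<le> (LINT x|M. 2 * (f x)\<^sup>2 + 2 * (g x)\<^sup>2)"
  proof (rule integral_mono)
    show "(f x + g x)\<^sup>2 \<le> 2 * (f x)\<^sup>2 + 2 * (g x)\<^sup>2" for x
      using sum_squares_bound[of "f x" "g x"] by (simp add: power2_sum)
  qed (use assms sq_int_add[OF assms] in \<open>auto intro!: Bochner_Integration.integrable_add\<close>)
  also have "\<dots> = 2 * sqnorm M f + 2 * sqnorm M g" using assms by (subst Bochner_Integration.integral_add) auto
  finally show ?thesis .
qed

lemma sqnorm_diff_commute: "sqnorm M (\<lambda>x. f x - g x) = sqnorm M (\<lambda>x. g x - f x)"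
  by (simp add: power2_commute)

lemma sqnorm_triangle:
  assumes "sq_int M f" "sq_int M g" "sq_int M h"
  shows "sqnorm M (\<lambda>x. f x - h x) \<le> 2 * sqnorm M (\<lambda>x. f x - g x) + 2 * sqnorm M (\<lambda>x. g x - h x)"
  using sqnorm_add_le[of M "\<lambda>x. f x - g x" "\<lambda>x. g x - h x"] assms by auto

lemma sqnorm_zero_AE:
  assumes "sq_int M f"
  shows "sqnorm M f = 0 \<longleftrightarrow> (AE x in M. f x = 0)"
  using assms by (subst integral_nonneg_eq_0_iff_AE) auto

lemma Cauchy_Schwarz_L2:
  assumes f: "sq_int M f" and g: "sq_int M g"
  shows "(inner_L2 M f g)\<^sup>2 \<le> sqnorm M f * sqnorm M g"
proof (cases "sqnorm M g = 0")
  case True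
  then have "AE x in M. g x = 0" using sqnorm_zero_AE[OF g] by simp
  then have "inner_L2 M f g = 0" by (intro integral_eq_zero_AE) auto
  with True show ?thesis by simp
next
  case False
  then have pos: "sqnorm M g > 0" using sqnorm_nonneg[of M g] by linarith
  \<comment> \<open>The minimizer of \<open>\<parallel>f + t g\<parallel>\<^sup>2\<close>.\<close>
  define t where "t = - inner_L2 M f g / sqnorm M g"
  have "0 \<le> sqnorm M (\<lambda>x. f x + t * g x)" by (rule sqnorm_nonneg)
  also have "\<dots> = sqnorm M f + 2 * t * inner_L2 M f g + t\<^sup>2 * sqnorm M g"
    using sqnorm_add[OF f sq_int_scale[OF g, of t]] sqnorm_scale[of M t g]
    by (simp add: mult.left_commute[of _ t])
  also have "\<dots> = sqnorm M f - (inner_L2 M f g)\<^sup>2 / sqnorm M g"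
    using pos by (simp add: t_def field_simps power2_eq_square)
  finally show ?thesis using pos by (simp add: field_simps)
qed

lemma abs_inner_L2_le:
  assumes f: "sq_int M f" and g: "sq_int M g"
  shows "\<bar>inner_L2 M f g\<bar> \<le> sqrt (sqnorm M f * sqnorm M g)"
  using Cauchy_Schwarz_L2[OF assms] by (metis real_le_rsqrt power2_abs)

lemma inner_L2_tendsto:
  assumes "\<And>n. sq_int M (f n)" "sq_int M f'" "sq_int M g"
    and lim: "(\<lambda>n. sqnorm M (\<lambda>x. f n x - f' x)) \<longlonglongrightarrow> 0"
  shows "(\<lambda>n. inner_L2 M (f n) g) \<longlonglongrightarrow> inner_L2 M f' g"
proof (rule LIM_zero_cancel, rule Lim_null_comparison)
  show "\<forall>\<^sub>F n in sequentially. norm (inner_L2 M (f n) g - inner_L2 M f' g)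
      \<le> sqrt (sqnorm M (\<lambda>x. f n x - f' x) * sqnorm M g)"
  proof (intro always_eventually allI)
    fix n
    show "norm (inner_L2 M (f n) g - inner_L2 M f' g) \<le> sqrt (sqnorm M (\<lambda>x. f n x - f' x) * sqnorm M g)"
      using abs_inner_L2_le[OF sq_int_diff[OF assms(1,2)] assms(3), of n] inner_L2_diff[OF assms(1-3), of n]
      by simp
  qed
  have "(\<lambda>n. sqrt (sqnorm M (\<lambda>x. f n x - f' x) * sqnorm M g)) \<longlonglongrightarrow> sqrt (0 * sqnorm M g)"
    by (intro tendsto_intros lim)
  then show "(\<lambda>n. sqrt (sqnorm M (\<lambda>x. f n x - f' x) * sqnorm M g)) \<longlonglongrightarrow> 0" by simp
qed

lemma sqnorm_tendsto:
  assumes "\<And>n. sq_int M (f n)" "sq_int M f'"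
    and lim: "(\<lambda>n. sqnorm M (\<lambda>x. f n x - f' x)) \<longlonglongrightarrow> 0"
  shows "(\<lambda>n. sqnorm M (f n)) \<longlonglongrightarrow> sqnorm M f'"
proof -
  have "sqnorm M (f n) = sqnorm M (\<lambda>x. f n x - f' x) + 2 * inner_L2 M (f n) f' - sqnorm M f'" for n
    using sqnorm_add[OF sq_int_diff[OF assms(1,2)] assms(2), of n] inner_L2_diff[OF assms(1,2,2), of n]
    by (simp add: power2_eq_square[of "f' _"])
  moreover have "(\<lambda>n. sqnorm M (\<lambda>x. f n x - f' x) + 2 * inner_L2 M (f n) f' - sqnorm M f')
      \<longlonglongrightarrow> 0 + 2 * inner_L2 M f' f' - sqnorm M f'"
    by (intro tendsto_intros lim inner_L2_tendsto assms)
  ultimately show ?thesis by (simp add: power2_eq_square[of "f' _"])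
qed

lemma (in prob_space) abs_expectation_le_L2:
  assumes "sq_int M f"
  shows "expectation (\<lambda>x. \<bar>f x\<bar>) \<le> sqrt (sqnorm M f)"
proof -
  have "sq_int M (\<lambda>x. \<bar>f x\<bar>)" using assms by (auto simp: sq_int_def)
  moreover have "sq_int M (\<lambda>x. 1)" by (simp add: sq_int_def)
  ultimately show ?thesis
    using abs_inner_L2_le[of M "\<lambda>x. \<bar>f x\<bar>" "\<lambda>x. 1"] by (simp add: prob_space)
qed

lemma (in finite_measure) sq_int_integrable: "sq_int M f \<Longrightarrow> integrable M f"
  using sq_int_mult[of M f "\<lambda>x. 1"] by (simp add: sq_int_def)

text \<open>Completeness of \<open>L\<^sup>2\<close>, for sequences that are Cauchy at a geometric rate: the increments are
  absolutely summable almost surely, and Fatou's lemma bounds the distance to the limit.\<close>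

lemma (in prob_space) L2_complete:
  fixes Y :: "nat \<Rightarrow> 'a \<Rightarrow> real"
  assumes Y: "\<And>n. sq_int M (Y n)"
    and cauchy: "\<And>n m. sqnorm M (\<lambda>x. Y n x - Y m x) \<le> (1/4)^n + (1/4)^m"
  obtains X where "sq_int M X" "(\<lambda>n. sqnorm M (\<lambda>x. Y n x - X x)) \<longlonglongrightarrow> 0"
proof -
  have Ym [measurable]: "Y n \<in> borel_measurable M" for n using Y by auto
  have D1: "expectation (\<lambda>x. \<bar>Y (Suc n) x - Y n x\<bar>) \<le> 2 * (1/2)^n" for n
  proof -
    have "expectation (\<lambda>x. \<bar>Y (Suc n) x - Y n x\<bar>) \<le> sqrt (sqnorm M (\<lambda>x. Y (Suc n) x - Y n x))"
      by (rule abs_expectation_le_L2) (auto intro: Y)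
    also have "\<dots> \<le> sqrt ((2 * (1/2)^n)\<^sup>2)"
    proof (rule real_sqrt_le_mono)
      have "sqnorm M (\<lambda>x. Y (Suc n) x - Y n x) \<le> (1/4)^Suc n + (1/4)^n" by (rule cauchy)
      also have "\<dots> \<le> 4 * (1/4)^n" by simp
      also have "\<dots> = (2 * (1/2)^n)\<^sup>2"
        by (simp add: power_mult_distrib power_divide flip: power_mult) (simp add: mult.commute[of n 2] power_mult)
      finally show "sqnorm M (\<lambda>x. Y (Suc n) x - Y n x) \<le> (2 * (1/2)^n)\<^sup>2" .
    qed
    finally show ?thesis by (simp only: real_sqrt_abs) simp
  qed
  have "(\<integral>\<^sup>+x. (\<Sum>n. ennreal \<bar>Y (Suc n) x - Y n x\<bar>) \<partial>M) = (\<Sum>n. \<integral>\<^sup>+x. ennreal \<bar>Y (Suc n) x - Y n x\<bar> \<partial>M)"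
    by (rule nn_integral_suminf) auto
  also have "\<dots> \<le> (\<Sum>n. ennreal (2 * (1/2)^n))"
  proof (rule suminf_le)
    fix n
    have "(\<integral>\<^sup>+x. ennreal \<bar>Y (Suc n) x - Y n x\<bar> \<partial>M) = ennreal (expectation (\<lambda>x. \<bar>Y (Suc n) x - Y n x\<bar>))"
    proof (rule nn_integral_eq_integral)
      show "integrable M (\<lambda>x. \<bar>Y (Suc n) x - Y n x\<bar>)"
        by (rule integrable_abs, rule sq_int_integrable, rule sq_int_diff, rule Y, rule Y)
    qed auto
    then show "(\<integral>\<^sup>+x. ennreal \<bar>Y (Suc n) x - Y n x\<bar> \<partial>M) \<le> ennreal (2 * (1/2)^n)"
      using D1[of n] by (simp add: ennreal_leI)
  qed auto
  also have "\<dots> = ennreal (\<Sum>n. 2 * (1/2)^n)"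
    by (rule suminf_ennreal2) (auto intro!: summable_mult summable_geometric)
  also have "\<dots> < \<infinity>" by simp
  finally have "AE x in M. (\<Sum>n. ennreal \<bar>Y (Suc n) x - Y n x\<bar>) \<noteq> \<infinity>"
    by (intro nn_integral_PInf_AE) auto
  then have conv: "AE x in M. convergent (\<lambda>n. Y n x)"
  proof eventually_elim
    case (elim x)
    then have "summable (\<lambda>n. \<bar>Y (Suc n) x - Y n x\<bar>)"
      by (intro summable_suminf_not_top) auto
    then have "summable (\<lambda>n. Y (Suc n) x - Y n x)" by (rule summable_rabs_cancel)
    then have "convergent (\<lambda>n. \<Sum>i<n. Y (Suc i) x - Y i x)" by (simp add: summable_iff_convergent)
    then have "convergent (\<lambda>n. Y 0 x + (\<Sum>i<n. Y (Suc i) x - Y i x))" by (intro convergent_add convergent_const)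
    moreover have "Y 0 x + (\<Sum>i<n. Y (Suc i) x - Y i x) = Y n x" for n
      by (subst sum_lessThan_telescope) simp
    ultimately show ?case by (simp only:)
  qed
  define X where "X x = lim (\<lambda>n. Y n x)" for x
  have Xm [measurable]: "X \<in> borel_measurable M"
    unfolding X_def by (rule borel_measurable_lim_metric) auto
  have fatou: "(\<integral>\<^sup>+x. ennreal ((Y n x - X x)\<^sup>2) \<partial>M) \<le> ennreal ((1/4)^n)" for n
  proof -
    have "(\<integral>\<^sup>+x. ennreal ((Y n x - X x)\<^sup>2) \<partial>M) = (\<integral>\<^sup>+x. liminf (\<lambda>m. ennreal ((Y n x - Y m x)\<^sup>2)) \<partial>M)"
    proof (rule nn_integral_cong_AE)
      show "AE x in M. ennreal ((Y n x - X x)\<^sup>2) = liminf (\<lambda>m. ennreal ((Y n x - Y m x)\<^sup>2))"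
        using conv
      proof eventually_elim
        case (elim x)
        then have "(\<lambda>m. Y m x) \<longlonglongrightarrow> X x" by (simp add: convergent_LIMSEQ_iff X_def)
        then have "(\<lambda>m. ennreal ((Y n x - Y m x)\<^sup>2)) \<longlonglongrightarrow> ennreal ((Y n x - X x)\<^sup>2)"
          by (intro tendsto_ennrealI tendsto_intros)
        then show ?case by (rule lim_imp_Liminf[OF trivial_limit_sequentially, symmetric])
      qed
    qed
    also have "\<dots> \<le> liminf (\<lambda>m. \<integral>\<^sup>+x. ennreal ((Y n x - Y m x)\<^sup>2) \<partial>M)"
      by (rule nn_integral_liminf) auto
    also have "\<dots> = liminf (\<lambda>m. ennreal (sqnorm M (\<lambda>x. Y n x - Y m x)))"
      using sq_int_diff[OF Y Y] by (subst nn_integral_eq_integral) auto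
    also have "\<dots> \<le> liminf (\<lambda>m. ennreal ((1/4)^n + (1/4)^m))"
      by (intro Liminf_mono always_eventually allI ennreal_leI cauchy)
    also have "\<dots> = ennreal ((1/4)^n + 0)"
      by (intro lim_imp_Liminf tendsto_ennrealI tendsto_add tendsto_const LIMSEQ_realpow_zero) auto
    finally show ?thesis by simp
  qed
  have sd: "sq_int M (\<lambda>x. Y n x - X x)" for n
    unfolding sq_int_def using fatou[of n]
    by (auto intro!: integrableI_bounded simp: le_less_trans[OF _ ennreal_less_top])
  have "sq_int M (\<lambda>x. Y 0 x - (Y 0 x - X x))" by (intro sq_int_diff Y sd)
  then have X: "sq_int M X" by simp
  have "sqnorm M (\<lambda>x. Y n x - X x) \<le> (1/4)^n" for n
    using fatou[of n] sd[of n] by (subst (asm) nn_integral_eq_integral) auto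
  then have "(\<lambda>n. sqnorm M (\<lambda>x. Y n x - X x)) \<longlonglongrightarrow> 0"
    by (intro Lim_null_comparison[OF _ LIMSEQ_realpow_zero[of "1/4"]] always_eventually)
       (auto simp: sqnorm_nonneg)
  with X show thesis by (rule that)
qed

section \<open>Centred Gaussian variables and characteristic functions\<close>

text \<open>Centred Gaussian variables described by their characteristic function, with the degenerate
  case included; this form is stable under limits in \<open>L\<^sup>2\<close>.\<close>

definition gaussian_char :: "'a measure \<Rightarrow> ('a \<Rightarrow> real) \<Rightarrow> bool" where
  "gaussian_char M X \<longleftrightarrow> sq_int M X \<and>
     (\<forall>s. (CLINT \<omega>|M. iexp (s * X \<omega>)) = complex_of_real (exp (- (s\<^sup>2 * sqnorm M X) / 2)))"

lemma std_normal_distributed_iff: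
  "distributed M lborel Z std_normal_density \<longleftrightarrow>
     Z \<in> borel_measurable M \<and> distr M borel Z = std_normal_distribution"
proof -
  have "distr M lborel Z = distr M borel Z" by (rule distr_cong) auto
  then show ?thesis by (auto simp: distributed_def)
qed

lemma (in prob_space) CLINT_iexp_eq_char:
  assumes [measurable]: "X \<in> borel_measurable M"
  shows "(CLINT \<omega>|M. iexp (s * X \<omega>)) = char (distr M borel X) s"
  unfolding char_def by (subst integral_distr) auto

lemma (in prob_space) centred_gaussian_iff_char:
  "centred_gaussian M X \<longleftrightarrow> gaussian_char M X"
proof
  assume G: "centred_gaussian M X"
  then have X [measurable]: "X \<in> borel_measurable M" by (simp add: centred_gaussian_def)
  consider (zero) "AE \<omega> in M. X \<omega> = 0"
    | (normal) \<sigma> where "\<sigma> > 0" "distributed M lborel X (normal_density 0 \<sigma>)"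
    using G by (auto simp: centred_gaussian_def)
  then show "gaussian_char M X"
  proof cases
    case zero
    have "sq_int M X \<longleftrightarrow> sq_int M (\<lambda>x. 0)"
      unfolding sq_int_def using zero by (auto intro!: integrable_cong_AE[THEN iffD2, of _ _ "\<lambda>_. 0"])
    then have sq: "sq_int M X" by (simp add: sq_int_def)
    have "sqnorm M X = 0" using sqnorm_zero_AE[OF sq] zero by simp
    moreover have "(CLINT \<omega>|M. iexp (s * X \<omega>)) = (CLINT \<omega>|M. 1)" for s
      using zero by (intro integral_cong_AE) auto
    ultimately show ?thesis using sq by (simp add: gaussian_char_def prob_space)
  next
    case normal
    have "integrable lborel (\<lambda>x. normal_density 0 \<sigma> x * (x - 0)\<^sup>2)"
      using normal(1) by (rule integrable_normal_moment)
    then have "integrable M (\<lambda>\<omega>. (X \<omega>)\<^sup>2)"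
      using distributed_integrable[OF normal(2), of "\<lambda>x. x\<^sup>2"] by simp
    then have sq: "sq_int M X" by (simp add: sq_int_def)
    have var: "sqnorm M X = \<sigma>\<^sup>2"
      using normal_distributed_variance[OF normal] normal_distributed_expectation[OF normal] by simp
    have "distributed M lborel (\<lambda>\<omega>. (X \<omega> - 0) / \<sigma>) std_normal_density"
      using normal_standard_normal_convert[OF normal(1), of X 0] normal(2) by simp
    then have Z: "distr M borel (\<lambda>\<omega>. X \<omega> / \<sigma>) = std_normal_distribution"
      by (simp add: std_normal_distributed_iff)
    have "(CLINT \<omega>|M. iexp (s * X \<omega>)) = complex_of_real (exp (- (s\<^sup>2 * sqnorm M X) / 2))" for s
    proof -
      have "(CLINT \<omega>|M. iexp (s * X \<omega>)) = (CLINT \<omega>|M. iexp ((s * \<sigma>) * (X \<omega> / \<sigma>)))"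
        using normal(1) by simp
      also have "\<dots> = char std_normal_distribution (s * \<sigma>)"
        by (subst CLINT_iexp_eq_char) (auto simp: Z)
      finally show ?thesis by (simp add: char_std_normal_distribution var power_mult_distrib)
    qed
    with sq show ?thesis by (simp add: gaussian_char_def)
  qed
next
  assume G: "gaussian_char M X"
  then have sq: "sq_int M X" and X [measurable]: "X \<in> borel_measurable M" by (auto simp: gaussian_char_def)
  show "centred_gaussian M X"
  proof (cases "sqnorm M X = 0")
    case True
    then show ?thesis using X sqnorm_zero_AE[OF sq] by (simp add: centred_gaussian_def)
  next
    case False
    define \<sigma> where "\<sigma> = sqrt (sqnorm M X)"
    have \<sigma>: "\<sigma> > 0" "\<sigma>\<^sup>2 = sqnorm M X"
      using False sqnorm_nonneg[of M X] by (simp_all add: \<sigma>_def less_le)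
    have "char (distr M borel (\<lambda>\<omega>. X \<omega> / \<sigma>)) t = char std_normal_distribution t" for t
    proof -
      have "char (distr M borel (\<lambda>\<omega>. X \<omega> / \<sigma>)) t = (CLINT \<omega>|M. iexp ((t / \<sigma>) * X \<omega>))"
        by (subst CLINT_iexp_eq_char[symmetric]) auto
      also have "\<dots> = complex_of_real (exp (- ((t / \<sigma>)\<^sup>2 * \<sigma>\<^sup>2) / 2))"
        using G \<sigma>(2) unfolding gaussian_char_def by metis
      also have "(t / \<sigma>)\<^sup>2 * \<sigma>\<^sup>2 = t\<^sup>2" using \<sigma>(1) by (simp add: power_divide)
      finally show ?thesis by (simp add: char_std_normal_distribution)
    qed
    then have "distr M borel (\<lambda>\<omega>. X \<omega> / \<sigma>) = std_normal_distribution"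
      by (intro Levy_uniqueness real_dist_normal_dist real_distribution_distr) auto
    then have "distributed M lborel (\<lambda>\<omega>. (X \<omega> - 0) / \<sigma>) std_normal_density"
      by (simp add: std_normal_distributed_iff)
    then have "distributed M lborel X (normal_density 0 \<sigma>)"
      using normal_standard_normal_convert[OF \<sigma>(1), of X 0] by simp
    with \<sigma>(1) X show ?thesis by (auto simp: centred_gaussian_def)
  qed
qed

lemma (in prob_space) sq_int_centred_gaussian: "centred_gaussian M X \<Longrightarrow> sq_int M X"
  by (simp add: centred_gaussian_iff_char gaussian_char_def)

lemma cmod_iexp_diff_le: "cmod (iexp a - iexp b) \<le> \<bar>a - b\<bar>"
proof -
  have "iexp a - iexp b = iexp b * (iexp (a - b) - 1)"
    by (simp add: right_diff_distrib exp_add[symmetric] algebra_simps)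
  then have "cmod (iexp a - iexp b) = cmod (iexp (a - b) - 1)"
    by (simp add: norm_mult)
  also have "\<dots> \<le> \<bar>a - b\<bar>" using iexp_approx1[of "a - b" 0] by simp
  finally show ?thesis .
qed

lemma (in prob_space) CLINT_iexp_tendsto:
  assumes X: "\<And>n. sq_int M (X n)" and Y: "sq_int M Y"
    and lim: "(\<lambda>n. sqnorm M (\<lambda>\<omega>. X n \<omega> - Y \<omega>)) \<longlonglongrightarrow> 0"
  shows "(\<lambda>n. CLINT \<omega>|M. iexp (s * X n \<omega>)) \<longlonglongrightarrow> (CLINT \<omega>|M. iexp (s * Y \<omega>))"
proof (rule LIM_zero_cancel, rule Lim_null_comparison)
  have [measurable]: "X n \<in> borel_measurable M" "Y \<in> borel_measurable M" for n using X Y by auto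
  show "\<forall>\<^sub>F n in sequentially. norm ((CLINT \<omega>|M. iexp (s * X n \<omega>)) - (CLINT \<omega>|M. iexp (s * Y \<omega>)))
      \<le> \<bar>s\<bar> * sqrt (sqnorm M (\<lambda>\<omega>. X n \<omega> - Y \<omega>))"
  proof (intro always_eventually allI)
    fix n
    have d: "sq_int M (\<lambda>\<omega>. X n \<omega> - Y \<omega>)" using X Y by auto
    have "(CLINT \<omega>|M. iexp (s * X n \<omega>)) - (CLINT \<omega>|M. iexp (s * Y \<omega>))
        = (CLINT \<omega>|M. iexp (s * X n \<omega>) - iexp (s * Y \<omega>))"
      by (intro Bochner_Integration.integral_diff[symmetric] integrable_iexp) auto
    also have "norm \<dots> \<le> expectation (\<lambda>\<omega>. norm (iexp (s * X n \<omega>) - iexp (s * Y \<omega>)))"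
      by (rule integral_norm_bound)
    also have "\<dots> \<le> expectation (\<lambda>\<omega>. \<bar>s\<bar> * \<bar>X n \<omega> - Y \<omega>\<bar>)"
    proof (rule integral_mono)
      show "integrable M (\<lambda>\<omega>. norm (iexp (s * X n \<omega>) - iexp (s * Y \<omega>)))"
        by (intro integrable_norm Bochner_Integration.integrable_diff integrable_iexp) auto
      show "integrable M (\<lambda>\<omega>. \<bar>s\<bar> * \<bar>X n \<omega> - Y \<omega>\<bar>)"
        using sq_int_integrable[OF d] by auto
      show "norm (iexp (s * X n \<omega>) - iexp (s * Y \<omega>)) \<le> \<bar>s\<bar> * \<bar>X n \<omega> - Y \<omega>\<bar>" for \<omega>
        using cmod_iexp_diff_le[of "s * X n \<omega>" "s * Y \<omega>"]
        by (simp add: abs_mult[symmetric] right_diff_distrib)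
    qed
    also have "\<dots> = \<bar>s\<bar> * expectation (\<lambda>\<omega>. \<bar>X n \<omega> - Y \<omega>\<bar>)" by simp
    also have "\<dots> \<le> \<bar>s\<bar> * sqrt (sqnorm M (\<lambda>\<omega>. X n \<omega> - Y \<omega>))"
      by (intro mult_left_mono abs_expectation_le_L2 d) auto
    finally show "norm ((CLINT \<omega>|M. iexp (s * X n \<omega>)) - (CLINT \<omega>|M. iexp (s * Y \<omega>)))
        \<le> \<bar>s\<bar> * sqrt (sqnorm M (\<lambda>\<omega>. X n \<omega> - Y \<omega>))" .
  qed
  have "(\<lambda>n. \<bar>s\<bar> * sqrt (sqnorm M (\<lambda>\<omega>. X n \<omega> - Y \<omega>))) \<longlonglongrightarrow> \<bar>s\<bar> * sqrt 0"
    by (intro tendsto_intros lim)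
  then show "(\<lambda>n. \<bar>s\<bar> * sqrt (sqnorm M (\<lambda>\<omega>. X n \<omega> - Y \<omega>))) \<longlonglongrightarrow> 0" by simp
qed

lemma (in prob_space) centred_gaussian_L2_limit:
  assumes X: "\<And>n. centred_gaussian M (X n)" and Y: "sq_int M Y"
    and lim: "(\<lambda>n. sqnorm M (\<lambda>\<omega>. X n \<omega> - Y \<omega>)) \<longlonglongrightarrow> 0"
  shows "centred_gaussian M Y"
  unfolding centred_gaussian_iff_char gaussian_char_def
proof (intro conjI allI Y)
  fix s
  have sq: "sq_int M (X n)" for n by (rule sq_int_centred_gaussian[OF X])
  have "(\<lambda>n. complex_of_real (exp (- (s\<^sup>2 * sqnorm M (X n)) / 2))) \<longlonglongrightarrow>
      complex_of_real (exp (- (s\<^sup>2 * sqnorm M Y) / 2))"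
    by (intro tendsto_intros sqnorm_tendsto[OF sq Y lim]) auto
  moreover have "(\<lambda>n. complex_of_real (exp (- (s\<^sup>2 * sqnorm M (X n)) / 2))) =
      (\<lambda>n. CLINT \<omega>|M. iexp (s * X n \<omega>))"
    using X by (simp add: centred_gaussian_iff_char gaussian_char_def)
  ultimately show "(CLINT \<omega>|M. iexp (s * Y \<omega>)) = complex_of_real (exp (- (s\<^sup>2 * sqnorm M Y) / 2))"
    using CLINT_iexp_tendsto[OF sq Y lim, of s] LIMSEQ_unique by metis
qed

section \<open>Independence of orthogonal Gaussian families\<close>

text \<open>The law of \<open>X\<close> under the probability measure with density \<open>P / m\<close>.\<close>

lemma (in prob_space) weighted_law:
  fixes P X :: "'a \<Rightarrow> real"
  assumes P: "integrable M P" "\<And>\<omega>. 0 \<le> P \<omega>" and m: "expectation P = m" "m > 0"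
    and X [measurable]: "X \<in> borel_measurable M"
  defines "\<mu> \<equiv> distr (density M (\<lambda>\<omega>. P \<omega> / m)) borel X"
  shows "real_distribution \<mu>"
    and "char \<mu> s = (CLINT \<omega>|M. complex_of_real (P \<omega>) * iexp (s * X \<omega>)) / m"
    and "A \<in> sets borel \<Longrightarrow> measure \<mu> A = expectation (\<lambda>\<omega>. P \<omega> * indicator A (X \<omega>)) / m"
proof -
  have [measurable]: "P \<in> borel_measurable M" using P by auto
  have "emeasure (density M (\<lambda>\<omega>. P \<omega> / m)) (space M) = (\<integral>\<^sup>+\<omega>. ennreal (P \<omega> / m) \<partial>M)"
    by (subst emeasure_density) (auto intro!: nn_integral_cong)
  also have "\<dots> = ennreal (expectation (\<lambda>\<omega>. P \<omega> / m))"
    using P m by (intro nn_integral_eq_integral) auto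
  also have "\<dots> = 1" using m by simp
  finally have D: "prob_space (density M (\<lambda>\<omega>. P \<omega> / m))" by (intro prob_spaceI) simp
  then show R: "real_distribution \<mu>"
    unfolding \<mu>_def by (intro prob_space.real_distribution_distr) auto
  have scale: "(P \<omega> / m) *\<^sub>R z = (complex_of_real (P \<omega>) * z) / m" for \<omega> z
    by (simp add: scaleR_conv_of_real)
  show "char \<mu> s = (CLINT \<omega>|M. complex_of_real (P \<omega>) * iexp (s * X \<omega>)) / m"
    unfolding char_def \<mu>_def using P(2) m
    by (subst integral_distr, simp, simp, subst integral_density) (auto simp: scale)
  assume [measurable]: "A \<in> sets borel"
  interpret R: real_distribution \<mu> by (rule R)
  have "measure \<mu> A = (LINT x|\<mu>. indicator A x)" by simp
  also have "\<dots> = expectation (\<lambda>\<omega>. (P \<omega> / m) *\<^sub>R indicator A (X \<omega>))"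
    unfolding \<mu>_def using P(2) m
    by (subst integral_distr, simp, simp, subst integral_density) auto
  finally show "measure \<mu> A = expectation (\<lambda>\<omega>. P \<omega> * indicator A (X \<omega>)) / m" by simp
qed

lemma (in prob_space) integrable_mult_iexp:
  fixes V :: "'a \<Rightarrow> complex"
  assumes V: "integrable M V" and [measurable]: "Y \<in> borel_measurable M"
  shows "integrable M (\<lambda>\<omega>. V \<omega> * iexp (Y \<omega>))"
proof (rule Bochner_Integration.integrable_bound[OF V])
  have [measurable]: "V \<in> borel_measurable M" using V by auto
  show "(\<lambda>\<omega>. V \<omega> * iexp (Y \<omega>)) \<in> borel_measurable M" by measurable
qed (simp add: norm_mult)

lemma (in prob_space) integrable_mult_indicator_comp:
  fixes V :: "'a \<Rightarrow> 'b :: {real_normed_field, banach, second_countable_topology}"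
  assumes V: "integrable M V" and [measurable]: "X \<in> borel_measurable M" "A \<in> sets borel"
  shows "integrable M (\<lambda>\<omega>. V \<omega> * indicator A (X \<omega>))"
proof (rule Bochner_Integration.integrable_bound[OF V])
  have [measurable]: "V \<in> borel_measurable M" using V by auto
  show "(\<lambda>\<omega>. V \<omega> * indicator A (X \<omega>)) \<in> borel_measurable M" by measurable
qed (simp add: norm_mult indicator_def)

text \<open>Uniqueness of the Fourier transform of the signed measure
  \<open>A \<mapsto> E[Z; X \<in> A]\<close>, obtained from the uniqueness for probability laws by splitting \<open>Z\<close> into
  its positive and negative parts.\<close>

lemma (in prob_space) fourier_zero_real:
  fixes Z X :: "'a \<Rightarrow> real"
  assumes Z: "integrable M Z" and X [measurable]: "X \<in> borel_measurable M"
    and zero: "\<And>s. (CLINT \<omega>|M. complex_of_real (Z \<omega>) * iexp (s * X \<omega>)) = 0"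
    and A [measurable]: "A \<in> sets borel"
  shows "expectation (\<lambda>\<omega>. Z \<omega> * indicator A (X \<omega>)) = 0"
proof -
  define P N where "P \<omega> = max (Z \<omega>) 0" and "N \<omega> = max (- Z \<omega>) 0" for \<omega>
  have ZPN: "Z \<omega> = P \<omega> - N \<omega>" for \<omega> by (auto simp: P_def N_def)
  have P: "integrable M P" "\<And>\<omega>. 0 \<le> P \<omega>" and N: "integrable M N" "\<And>\<omega>. 0 \<le> N \<omega>"
    using Z by (auto simp: P_def[abs_def] N_def[abs_def])
  define m where "m = expectation P"
  have "complex_of_real (expectation Z) = 0" using zero[of 0] by simp
  then have "expectation Z = 0" by simp
  then have mN: "expectation N = m" using Bochner_Integration.integral_diff[OF P(1) N(1)] by (simp add: m_def flip: ZPN)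
  show ?thesis
  proof (cases "m = 0")
    case True
    have "AE \<omega> in M. P \<omega> = 0" "AE \<omega> in M. N \<omega> = 0"
      using True mN P N integral_nonneg_eq_0_iff_AE[of M P] integral_nonneg_eq_0_iff_AE[of M N]
      by (auto simp: m_def)
    then have "AE \<omega> in M. Z \<omega> * indicator A (X \<omega>) = 0" by eventually_elim (simp add: ZPN)
    then show ?thesis by (rule integral_eq_zero_AE)
  next
    case False
    moreover have "m \<ge> 0" unfolding m_def using P by (intro integral_nonneg_AE) auto
    ultimately have m: "m > 0" by simp
    note lawP = weighted_law[OF P m_def[symmetric] m X]
    note lawN = weighted_law[OF N mN m X]
    have "char (distr (density M (\<lambda>\<omega>. P \<omega> / m)) borel X) s
        = char (distr (density M (\<lambda>\<omega>. N \<omega> / m)) borel X) s" for s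
    proof -
      have "(CLINT \<omega>|M. complex_of_real (P \<omega>) * iexp (s * X \<omega>)) - (CLINT \<omega>|M. complex_of_real (N \<omega>) * iexp (s * X \<omega>))
        = (CLINT \<omega>|M. complex_of_real (P \<omega>) * iexp (s * X \<omega>) - complex_of_real (N \<omega>) * iexp (s * X \<omega>))"
        using P N by (intro Bochner_Integration.integral_diff[symmetric] integrable_mult_iexp) auto
      also have "\<dots> = 0" using zero[of s] by (simp add: ZPN left_diff_distrib)
      finally show ?thesis unfolding lawP(2) lawN(2) by simp
    qed
    then have "distr (density M (\<lambda>\<omega>. P \<omega> / m)) borel X = distr (density M (\<lambda>\<omega>. N \<omega> / m)) borel X"
      by (intro Levy_uniqueness lawP lawN) auto
    then have "expectation (\<lambda>\<omega>. P \<omega> * indicator A (X \<omega>)) = expectation (\<lambda>\<omega>. N \<omega> * indicator A (X \<omega>))"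
      using lawP(3)[OF A] lawN(3)[OF A] m by simp
    moreover have "expectation (\<lambda>\<omega>. Z \<omega> * indicator A (X \<omega>))
      = expectation (\<lambda>\<omega>. P \<omega> * indicator A (X \<omega>)) - expectation (\<lambda>\<omega>. N \<omega> * indicator A (X \<omega>))"
      unfolding ZPN left_diff_distrib using P N
      by (intro Bochner_Integration.integral_diff integrable_mult_indicator_comp) auto
    ultimately show ?thesis by simp
  qed
qed

lemma (in prob_space) fourier_zero:
  fixes V :: "'a \<Rightarrow> complex" and X :: "'a \<Rightarrow> real"
  assumes V: "integrable M V" and X [measurable]: "X \<in> borel_measurable M"
    and zero: "\<And>s. (CLINT \<omega>|M. V \<omega> * iexp (s * X \<omega>)) = 0"
    and A [measurable]: "A \<in> sets borel"
  shows "(CLINT \<omega>|M. V \<omega> * indicator A (X \<omega>)) = 0"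
proof -
  have cnj_iexp: "cnj (iexp y) = iexp (- y)" for y
    by (simp add: cis_conv_exp[symmetric] cis_cnj del: of_real_minus)
  have cnjz: "(CLINT \<omega>|M. cnj (V \<omega>) * iexp (s * X \<omega>)) = 0" for s
  proof -
    have "(CLINT \<omega>|M. cnj (V \<omega>) * iexp (s * X \<omega>)) = (CLINT \<omega>|M. cnj (V \<omega> * iexp ((-s) * X \<omega>)))"
      by (intro Bochner_Integration.integral_cong refl) (simp only: complex_cnj_mult cnj_iexp, simp)
    also have "\<dots> = 0" by (subst Bochner_Integration.integral_cnj, subst zero) (rule complex_cnj_zero)
    finally show ?thesis .
  qed
  have sX: "(\<lambda>\<omega>. s * X \<omega>) \<in> borel_measurable M" for s by simp
  note int = integrable_mult_iexp[OF V sX] integrable_mult_iexp[OF integrable_cnj[OF V] sX]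
  have re: "complex_of_real (Re z) = (z + cnj z) / 2" and im: "complex_of_real (Im z) = (z - cnj z) / (2 * \<i>)" for z
    by (auto simp: complex_eq_iff)
  have "(CLINT \<omega>|M. complex_of_real (Re (V \<omega>)) * iexp (s * X \<omega>)) = 0" for s
    unfolding re times_divide_eq_left distrib_right
    using Bochner_Integration.integral_add[OF int, of s s] zero[of s] cnjz[of s] by simp
  then have 1: "expectation (\<lambda>\<omega>. Re (V \<omega>) * indicator A (X \<omega>)) = 0"
    using V by (intro fourier_zero_real) auto
  have "(CLINT \<omega>|M. complex_of_real (Im (V \<omega>)) * iexp (s * X \<omega>)) = 0" for s
    unfolding im times_divide_eq_left left_diff_distrib
    using Bochner_Integration.integral_diff[OF int, of s s] zero[of s] cnjz[of s] by simp
  then have 2: "expectation (\<lambda>\<omega>. Im (V \<omega>) * indicator A (X \<omega>)) = 0"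
    using V by (intro fourier_zero_real) auto
  have I: "integrable M (\<lambda>\<omega>. V \<omega> * indicator A (X \<omega>))"
    using V by (intro integrable_mult_indicator_comp) auto
  have "Re (z * indicator A x) = Re z * indicator A x" "Im (z * indicator A x) = Im z * indicator A x"
    for z and x :: real by (auto simp: indicator_def)
  then show ?thesis using 1 2 by (simp add: complex_eq_iff flip: integral_Re[OF I] integral_Im[OF I])
qed

text \<open>One coordinate at a time, exponentials of a linear space of variables may be replaced by
  indicators of finitely many of its members.\<close>

lemma (in prob_space) fourier_zero_cylinder:
  fixes V :: "'a \<Rightarrow> complex" and \<L> :: "('a \<Rightarrow> real) set"
  assumes V: "integrable M V" and meas: "\<And>Y. Y \<in> \<L> \<Longrightarrow> Y \<in> borel_measurable M"
    and lin: "\<And>Y Z s. Y \<in> \<L> \<Longrightarrow> Z \<in> \<L> \<Longrightarrow> (\<lambda>\<omega>. Y \<omega> + s * Z \<omega>) \<in> \<L>"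
    and zero: "\<And>Y. Y \<in> \<L> \<Longrightarrow> (CLINT \<omega>|M. V \<omega> * iexp (Y \<omega>)) = 0"
    and S: "finite S" "\<And>k. k \<in> S \<Longrightarrow> X k \<in> \<L>" "\<And>k. k \<in> S \<Longrightarrow> E k \<in> sets borel"
    and Y: "Y \<in> \<L>"
  shows "(CLINT \<omega>|M. V \<omega> * (\<Prod>k\<in>S. indicator (E k) (X k \<omega>)) * iexp (Y \<omega>)) = 0"
  using S Y
proof (induction S arbitrary: Y rule: finite_induct)
  case empty
  then show ?case using zero by simp
next
  case (insert k S)
  have mX: "X i \<in> borel_measurable M" if "i \<in> insert k S" for i using insert.prems meas that by auto
  have intS: "integrable M (\<lambda>\<omega>. V \<omega> * (\<Prod>k\<in>T. indicator (E k) (X k \<omega>)))" if "T \<subseteq> insert k S" for T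
    using finite_subset[OF that] that
  proof (induction T rule: infinite_finite_induct)
    case (insert i T)
    then have "integrable M (\<lambda>\<omega>. V \<omega> * (\<Prod>k\<in>T. indicator (E k) (X k \<omega>)) * indicator (E i) (X i \<omega>))"
      using mX \<open>\<And>k'. k' \<in> insert k S \<Longrightarrow> E k' \<in> sets borel\<close>
      by (intro integrable_mult_indicator_comp) auto
    then show ?case using insert by (simp add: mult_ac)
  qed (use V \<open>finite S\<close> in auto)
  let ?U = "\<lambda>\<omega>. V \<omega> * (\<Prod>k\<in>S. indicator (E k) (X k \<omega>)) * iexp (Y \<omega>)"
  have "(CLINT \<omega>|M. ?U \<omega> * indicator (E k) (X k \<omega>)) = 0"
  proof (rule fourier_zero)
    show "integrable M ?U" using intS[of S] meas insert.prems by (intro integrable_mult_iexp) auto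
    fix s
    have "(CLINT \<omega>|M. V \<omega> * (\<Prod>k\<in>S. indicator (E k) (X k \<omega>)) * iexp (Y \<omega> + s * X k \<omega>)) = 0"
      using insert.prems lin by (intro insert.IH) auto
    then show "(CLINT \<omega>|M. ?U \<omega> * iexp (s * X k \<omega>)) = 0"
      by (simp add: exp_add distrib_left mult.assoc)
  qed (use mX insert.prems in auto)
  then show ?case using insert.hyps by (simp add: mult_ac)
qed

text \<open>A linear space of centred Gaussian variables: for its members, orthogonality amounts to
  independence.\<close>

locale gaussian_space = prob_space M for M :: "'a measure" +
  fixes \<G> :: "('a \<Rightarrow> real) set"
  assumes gaussian: "Y \<in> \<G> \<Longrightarrow> centred_gaussian M Y"
    and zero_mem: "(\<lambda>_. 0) \<in> \<G>"
    and lin_mem: "Y \<in> \<G> \<Longrightarrow> Z \<in> \<G> \<Longrightarrow> (\<lambda>\<omega>. Y \<omega> + s * Z \<omega>) \<in> \<G>"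
begin

lemma sq_int_mem: "Y \<in> \<G> \<Longrightarrow> sq_int M Y"
  by (intro sq_int_centred_gaussian gaussian)

lemma CLINT_iexp_mem:
  assumes "Y \<in> \<G>"
  shows "(CLINT \<omega>|M. iexp (Y \<omega>)) = complex_of_real (exp (- sqnorm M Y / 2))"
proof -
  have "(CLINT \<omega>|M. iexp (1 * Y \<omega>)) = complex_of_real (exp (- (1\<^sup>2 * sqnorm M Y) / 2))"
    using gaussian[OF assms] unfolding centred_gaussian_iff_char gaussian_char_def by blast
  then show ?thesis by simp
qed

lemma CLINT_iexp_add_orthogonal:
  assumes "Y \<in> \<G>" "Z \<in> \<G>" "inner_L2 M Y Z = 0"
  shows "(CLINT \<omega>|M. iexp (Y \<omega> + Z \<omega>)) = (CLINT \<omega>|M. iexp (Y \<omega>)) * (CLINT \<omega>|M. iexp (Z \<omega>))"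
proof -
  have "(\<lambda>\<omega>. Y \<omega> + Z \<omega>) \<in> \<G>" using lin_mem[OF assms(1,2), of 1] by simp
  then have "(CLINT \<omega>|M. iexp (Y \<omega> + Z \<omega>)) = complex_of_real (exp (- (sqnorm M Y + sqnorm M Z) / 2))"
    using CLINT_iexp_mem[of "\<lambda>\<omega>. Y \<omega> + Z \<omega>"] sqnorm_add[of M Y Z] assms sq_int_mem by simp
  also have "- (sqnorm M Y + sqnorm M Z) / 2 = - sqnorm M Y / 2 + - sqnorm M Z / 2" by (simp add: field_simps)
  finally show ?thesis by (simp only: CLINT_iexp_mem[OF assms(1)] CLINT_iexp_mem[OF assms(2)] exp_add of_real_mult)
qed

text \<open>The blocks \<open>X j\<close>, \<open>j \<in> J\<close>, are processed one at a time; the factor \<open>iexp (Y \<omega>)\<close>, with \<open>Y\<close> orthogonal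
  to the processed blocks, keeps the information on the others.\<close>

lemma cylinder_factorization:
  fixes X :: "'i \<Rightarrow> 'k \<Rightarrow> 'a \<Rightarrow> real"
  assumes mem: "\<And>i k. i \<in> I \<Longrightarrow> k \<in> K i \<Longrightarrow> X i k \<in> \<G>"
    and orth: "\<And>i j k l. i \<in> I \<Longrightarrow> j \<in> I \<Longrightarrow> i \<noteq> j \<Longrightarrow> k \<in> K i \<Longrightarrow> l \<in> K j \<Longrightarrow>
      inner_L2 M (X i k) (X j l) = 0"
    and J: "finite J" "J \<subseteq> I"
    and S: "\<And>j. j \<in> J \<Longrightarrow> finite (S j)" "\<And>j. j \<in> J \<Longrightarrow> S j \<subseteq> K j"
    and E: "\<And>j k. j \<in> J \<Longrightarrow> k \<in> S j \<Longrightarrow> E j k \<in> sets borel"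
    and Y: "Y \<in> \<G>" "\<And>j k. j \<in> J \<Longrightarrow> k \<in> K j \<Longrightarrow> inner_L2 M Y (X j k) = 0"
  defines "D \<equiv> \<lambda>j. {\<omega>\<in>space M. \<forall>k\<in>S j. X j k \<omega> \<in> E j k}"
  shows "(CLINT \<omega>|M. (\<Prod>j\<in>J. indicator (D j) \<omega>) * iexp (Y \<omega>))
    = (\<Prod>j\<in>J. complex_of_real (prob (D j))) * (CLINT \<omega>|M. iexp (Y \<omega>))"
  using J S E Y
proof (induction J arbitrary: Y rule: finite_induct)
  case (insert j J)
  have meas [measurable]: "Z \<in> borel_measurable M" if "Z \<in> \<G>" for Z using sq_int_mem[OF that] by auto
  have D [measurable]: "D i \<in> events" if "i \<in> insert j J" for i
  proof -
    have [measurable]: "X i k \<in> borel_measurable M" if "k \<in> S i" for k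
      by (intro meas mem) (use insert.prems(1) insert.prems(3)[of i] that \<open>i \<in> insert j J\<close> in blast)+
    note [measurable] = insert.prems(4)[OF \<open>i \<in> insert j J\<close>]
    show ?thesis unfolding D_def using insert.prems(2)[OF \<open>i \<in> insert j J\<close>] by measurable
  qed
  have bdd: "integrable M (\<lambda>\<omega>. (\<Prod>i\<in>J. indicator (D i) \<omega>) :: complex)"
  proof (rule integrable_const_bound[of _ 1])
    show "AE \<omega> in M. norm (\<Prod>i\<in>J. indicator (D i) \<omega> :: complex) \<le> 1"
      unfolding prod_norm[symmetric] by (intro AE_I2 prod_le_1) (auto simp: indicator_def)
    show "(\<lambda>\<omega>. (\<Prod>i\<in>J. indicator (D i) \<omega>) :: complex) \<in> borel_measurable M"
      using D by (intro borel_measurable_prod borel_measurable_indicator) auto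
  qed
  \<comment> \<open>The double orthogonal complement of block \<open>j\<close> in \<open>\<G>\<close>, a linear space that contains the block.\<close>
  define \<L> where "\<L> = {Z \<in> \<G>. \<forall>Y'\<in>\<G>. (\<forall>k\<in>K j. inner_L2 M Y' (X j k) = 0) \<longrightarrow> inner_L2 M Y' Z = 0}"
  have XL: "X j k \<in> \<L>" if "k \<in> K j" for k
    using that mem insert.prems(1) by (auto simp: \<L>_def)
  have LG: "Z \<in> \<G>" if "Z \<in> \<L>" for Z using that by (simp add: \<L>_def)
  have lin: "(\<lambda>\<omega>. Z \<omega> + s * Z' \<omega>) \<in> \<L>" if "Z \<in> \<L>" "Z' \<in> \<L>" for Z Z' s
  proof -
    have "inner_L2 M Y' (\<lambda>\<omega>. Z \<omega> + s * Z' \<omega>) = inner_L2 M Y' Z + s * inner_L2 M Y' Z'" if "Y' \<in> \<G>" for Y'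
      using inner_L2_add[of M Z "\<lambda>\<omega>. s * Z' \<omega>" Y'] inner_L2_scale[of M s Z' Y']
        sq_int_mem[OF LG[OF \<open>Z \<in> \<L>\<close>]] sq_int_scale[OF sq_int_mem[OF LG[OF \<open>Z' \<in> \<L>\<close>]], of s]
        sq_int_mem[OF that] by (simp add: mult.commute[of "Y' _"])
    with that show ?thesis unfolding \<L>_def by (auto intro: lin_mem)
  qed
  have zeroL: "(\<lambda>_. 0) \<in> \<L>" by (auto simp: \<L>_def zero_mem)
  have YZ: "inner_L2 M Y Z = 0" if "Z \<in> \<L>" for Z
    using that insert.prems by (auto simp: \<L>_def)
  have ZX: "inner_L2 M Z (X i k) = 0" if "Z \<in> \<L>" "i \<in> J" "k \<in> K i" for Z i k
  proof -
    have "i \<in> I" "j \<in> I" "i \<noteq> j" using insert.prems(1) insert.hyps(2) that by auto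
    then have "inner_L2 M (X i k) Z = 0" using that mem orth by (auto simp: \<L>_def)
    then show ?thesis by (simp add: mult.commute)
  qed
  have YZG: "(\<lambda>\<omega>. Y \<omega> + Z \<omega>) \<in> \<G>" if "Z \<in> \<L>" for Z
    using lin_mem[OF insert.prems(5) LG[OF that], of 1] by simp
  define c where "c = (\<Prod>i\<in>J. complex_of_real (prob (D i)))"
  have IH: "(CLINT \<omega>|M. (\<Prod>i\<in>J. indicator (D i) \<omega>) * iexp (Y \<omega> + Z \<omega>)) = c * (CLINT \<omega>|M. iexp (Y \<omega> + Z \<omega>))"
    if Z: "Z \<in> \<L>" for Z
    unfolding c_def
  proof (rule insert.IH)
    show "inner_L2 M (\<lambda>\<omega>. Y \<omega> + Z \<omega>) (X i k) = 0" if "i \<in> J" "k \<in> K i" for i k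
      using inner_L2_add[of M Y Z "X i k"] ZX[OF Z that] insert.prems that mem LG[OF Z] sq_int_mem by auto
  qed (use insert.prems YZG[OF Z] in auto)
  have prod_ind: "(\<Prod>k\<in>S j. indicator (E j k) (X j k \<omega>)) = (indicator (D j) \<omega> :: complex)"
    if "\<omega> \<in> space M" for \<omega>
  proof (cases "\<omega> \<in> D j")
    case True then show ?thesis by (auto simp: D_def intro!: prod.neutral)
  next
    case False
    then obtain k where "k \<in> S j" "X j k \<omega> \<notin> E j k" using \<open>\<omega> \<in> space M\<close> by (auto simp: D_def)
    then show ?thesis using False insert.prems(2)[of j]
      by (auto intro!: prod_zero bexI[of _ k] simp: indicator_def)
  qed
  have cyl: "(CLINT \<omega>|M. V \<omega> * indicator (D j) \<omega>) = 0"
    if V: "integrable M V" "\<And>Z. Z \<in> \<L> \<Longrightarrow> (CLINT \<omega>|M. V \<omega> * iexp (Z \<omega>)) = 0" for V :: "'a \<Rightarrow> complex"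
  proof -
    have "(CLINT \<omega>|M. V \<omega> * (\<Prod>k\<in>S j. indicator (E j k) (X j k \<omega>)) * iexp 0) = 0"
    proof (rule fourier_zero_cylinder[OF V(1) _ lin V(2)])
      show "X j k \<in> \<L>" if "k \<in> S j" for k using insert.prems(3)[of j] XL that by blast
      show "E j k \<in> sets borel" if "k \<in> S j" for k using insert.prems(4) that by blast
    qed (use insert.prems(2) LG meas zeroL in auto)
    then show ?thesis using prod_ind by (simp cong: Bochner_Integration.integral_cong)
  qed
  have intY: "integrable M (\<lambda>\<omega>. iexp (Y \<omega>))" using insert.prems meas by (intro integrable_iexp) auto
  let ?P = "\<lambda>\<omega>. (\<Prod>i\<in>J. indicator (D i) \<omega>) :: complex"
  have intPY: "integrable M (\<lambda>\<omega>. ?P \<omega> * iexp (Y \<omega>))"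
    using insert.prems meas by (intro integrable_mult_iexp bdd) auto
  have intYD: "integrable M (\<lambda>\<omega>. U \<omega> * indicator (D j) \<omega>)" if "integrable M U" for U :: "'a \<Rightarrow> complex"
  proof -
    have "indicator (D j) \<omega> *\<^sub>R U \<omega> = U \<omega> * indicator (D j) \<omega>" for \<omega> by (auto simp: indicator_def)
    then show ?thesis using integrable_mult_indicator[OF D that, of j] by simp
  qed
  \<comment> \<open>Both variables below are annihilated by all exponentials of members of \<open>\<L>\<close>,
    hence by the indicator of \<open>D j\<close>.\<close>
  have 1: "(CLINT \<omega>|M. (?P \<omega> * iexp (Y \<omega>) - c * iexp (Y \<omega>)) * indicator (D j) \<omega>) = 0"
  proof (rule cyl)
    show "integrable M (\<lambda>\<omega>. ?P \<omega> * iexp (Y \<omega>) - c * iexp (Y \<omega>))" using intPY intY by auto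
    fix Z assume Z: "Z \<in> \<L>"
    have "(CLINT \<omega>|M. (?P \<omega> * iexp (Y \<omega>) - c * iexp (Y \<omega>)) * iexp (Z \<omega>))
      = (CLINT \<omega>|M. ?P \<omega> * iexp (Y \<omega> + Z \<omega>) - c * iexp (Y \<omega> + Z \<omega>))"
      by (simp add: exp_add distrib_left left_diff_distrib mult.assoc)
    also have "\<dots> = (CLINT \<omega>|M. ?P \<omega> * iexp (Y \<omega> + Z \<omega>)) - (CLINT \<omega>|M. c * iexp (Y \<omega> + Z \<omega>))"
      using meas[OF insert.prems(5)] meas[OF LG[OF Z]]
      by (intro Bochner_Integration.integral_diff integrable_mult_iexp bdd integrable_mult_right integrable_iexp) auto
    also have "\<dots> = 0" using IH[OF Z] by simp
    finally show "(CLINT \<omega>|M. (?P \<omega> * iexp (Y \<omega>) - c * iexp (Y \<omega>)) * iexp (Z \<omega>)) = 0" .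
  qed
  define y where "y = (CLINT \<omega>|M. iexp (Y \<omega>))"
  have 2: "(CLINT \<omega>|M. (iexp (Y \<omega>) - y) * indicator (D j) \<omega>) = 0"
  proof (rule cyl)
    show "integrable M (\<lambda>\<omega>. iexp (Y \<omega>) - y)" using intY by auto
    fix Z assume Z: "Z \<in> \<L>"
    have "(CLINT \<omega>|M. (iexp (Y \<omega>) - y) * iexp (Z \<omega>)) = (CLINT \<omega>|M. iexp (Y \<omega> + Z \<omega>) - y * iexp (Z \<omega>))"
      by (simp add: exp_add distrib_left left_diff_distrib mult.assoc)
    also have "\<dots> = (CLINT \<omega>|M. iexp (Y \<omega> + Z \<omega>)) - (CLINT \<omega>|M. y * iexp (Z \<omega>))"
      using meas[OF insert.prems(5)] meas[OF LG[OF Z]]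
      by (intro Bochner_Integration.integral_diff integrable_mult_right integrable_iexp) auto
    also have "\<dots> = 0"
      using CLINT_iexp_add_orthogonal[OF insert.prems(5) LG[OF Z] YZ[OF Z]] by (simp add: y_def)
    finally show "(CLINT \<omega>|M. (iexp (Y \<omega>) - y) * iexp (Z \<omega>)) = 0" .
  qed
  have "(CLINT \<omega>|M. ?P \<omega> * iexp (Y \<omega>) * indicator (D j) \<omega>) = (CLINT \<omega>|M. c * iexp (Y \<omega>) * indicator (D j) \<omega>)"
    using 1 intYD[OF intPY] intYD[of "\<lambda>\<omega>. c * iexp (Y \<omega>)"] intY by (simp add: left_diff_distrib)
  also have "\<dots> = c * (CLINT \<omega>|M. iexp (Y \<omega>) * indicator (D j) \<omega>)" by (simp add: mult.assoc)
  also have "(CLINT \<omega>|M. iexp (Y \<omega>) * indicator (D j) \<omega>) = (CLINT \<omega>|M. y * indicator (D j) \<omega>)"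
    using 2 intYD[OF intY] intYD[of "\<lambda>\<omega>. y"] by (simp add: left_diff_distrib)
  also have "\<dots> = y * complex_of_real (prob (D j))"
  proof -
    have "(CLINT \<omega>|M. indicator (D j) \<omega>) = (CLINT \<omega>|M. complex_of_real (indicator (D j) \<omega>))"
      by (intro Bochner_Integration.integral_cong) (auto simp: indicator_def)
    then show ?thesis using D[of j] by (simp add: Int_absorb2 sets.sets_into_space)
  qed
  finally show ?case using insert.hyps by (simp add: c_def y_def mult_ac)
qed simp

theorem orthogonal_families_indep:
  fixes X :: "'i \<Rightarrow> 'k \<Rightarrow> 'a \<Rightarrow> real"
  assumes mem: "\<And>i k. i \<in> I \<Longrightarrow> k \<in> K i \<Longrightarrow> X i k \<in> \<G>"
    and orth: "\<And>i j k l. i \<in> I \<Longrightarrow> j \<in> I \<Longrightarrow> i \<noteq> j \<Longrightarrow> k \<in> K i \<Longrightarrow> l \<in> K j \<Longrightarrow>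
      inner_L2 M (X i k) (X j l) = 0"
  shows "indep_vars (\<lambda>i. \<Pi>\<^sub>M k\<in>K i. (borel :: real measure)) (\<lambda>i \<omega>. \<lambda>k\<in>K i. X i k \<omega>) I"
proof -
  let ?N = "\<lambda>i. \<Pi>\<^sub>M k\<in>K i. (borel :: real measure)"
  let ?X = "\<lambda>i \<omega>. \<lambda>k\<in>K i. X i k \<omega>"
  let ?F = "\<lambda>i. {?X i -` A \<inter> space M | A. A \<in> prod_algebra (K i) (\<lambda>_. borel :: real measure)}"
  have meas: "X i k \<in> borel_measurable M" if "i \<in> I" "k \<in> K i" for i k
    using sq_int_mem[OF mem[OF that]] by auto
  have rv: "?X i \<in> M \<rightarrow>\<^sub>M ?N i" if "i \<in> I" for i
    using meas[OF that] by (intro measurable_restrict) auto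
  have gen: "{?X i -` A \<inter> space M | A. A \<in> sets (?N i)} = sigma_sets (space M) (?F i)" for i
    unfolding sets_PiM by (rule sigma_sets_vimage_commute) auto
  have stable: "Int_stable (?F i)" for i
  proof (rule Int_stableI)
    fix a b assume "a \<in> ?F i" "b \<in> ?F i"
    then obtain A B where AB: "a = ?X i -` A \<inter> space M" "b = ?X i -` B \<inter> space M"
      "A \<in> prod_algebra (K i) (\<lambda>_. borel)" "B \<in> prod_algebra (K i) (\<lambda>_. borel)" by blast
    have "A \<inter> B \<in> prod_algebra (K i) (\<lambda>_. borel)"
      using AB(3,4) by (intro Int_stableD[OF Int_stable_prod_algebra])
    moreover have "a \<inter> b = ?X i -` (A \<inter> B) \<inter> space M" unfolding AB(1,2) by (simp add: Int_ac)
    ultimately show "a \<inter> b \<in> ?F i" by (intro CollectI exI[of _ "A \<inter> B"] conjI)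
  qed
  have "indep_sets ?F I"
  proof (rule indep_setsI)
    fix i assume i: "i \<in> I"
    have "prod_algebra (K i) (\<lambda>_. borel) \<subseteq> sets (?N i)" unfolding sets_PiM by auto
    then show "?F i \<subseteq> events" using measurable_sets[OF rv[OF i]] by blast
  next
    fix A J assume J: "J \<noteq> {}" "J \<subseteq> I" "finite J" and A: "\<forall>j\<in>J. A j \<in> ?F j"
    have "\<forall>j\<in>J. \<exists>S E. finite S \<and> S \<subseteq> K j \<and> (\<forall>k\<in>S. E k \<in> sets borel) \<and>
        A j = {\<omega>\<in>space M. \<forall>k\<in>S. X j k \<omega> \<in> E k}"
    proof
      fix j assume "j \<in> J"
      then obtain B where B: "A j = ?X j -` B \<inter> space M" "B \<in> prod_algebra (K j) (\<lambda>_. borel)" using A by blast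
      from prod_algebraE[OF B(2)] obtain S E where SE: "B = prod_emb (K j) (\<lambda>_. borel) S (\<Pi>\<^sub>E k\<in>S. E k)"
        "finite S" "S \<subseteq> K j" "\<And>k. k \<in> S \<Longrightarrow> E k \<in> sets borel" by metis
      have "A j = {\<omega>\<in>space M. \<forall>k\<in>S. X j k \<omega> \<in> E k}"
        unfolding B(1) SE(1) using SE(3) by (auto simp: prod_emb_def PiE_iff subset_iff split: if_split_asm)
      with SE show "\<exists>S E. finite S \<and> S \<subseteq> K j \<and> (\<forall>k\<in>S. E k \<in> sets borel) \<and>
        A j = {\<omega>\<in>space M. \<forall>k\<in>S. X j k \<omega> \<in> E k}" by blast
    qed
    from bchoice[OF this] obtain S where "\<forall>j\<in>J. \<exists>E. finite (S j) \<and> S j \<subseteq> K j \<and>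
        (\<forall>k\<in>S j. E k \<in> sets borel) \<and> A j = {\<omega>\<in>space M. \<forall>k\<in>S j. X j k \<omega> \<in> E k}" by blast
    from bchoice[OF this] obtain E where "\<forall>j\<in>J. finite (S j) \<and> S j \<subseteq> K j \<and>
        (\<forall>k\<in>S j. E j k \<in> sets borel) \<and> A j = {\<omega>\<in>space M. \<forall>k\<in>S j. X j k \<omega> \<in> E j k}" by blast
    then have SE: "\<And>j. j \<in> J \<Longrightarrow> finite (S j)" "\<And>j. j \<in> J \<Longrightarrow> S j \<subseteq> K j"
      "\<And>j k. j \<in> J \<Longrightarrow> k \<in> S j \<Longrightarrow> E j k \<in> sets borel"
      "\<And>j. j \<in> J \<Longrightarrow> A j = {\<omega>\<in>space M. \<forall>k\<in>S j. X j k \<omega> \<in> E j k}"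
      by auto
    have "(CLINT \<omega>|M. (\<Prod>j\<in>J. indicator {\<omega>\<in>space M. \<forall>k\<in>S j. X j k \<omega> \<in> E j k} \<omega>) * iexp 0)
        = (\<Prod>j\<in>J. complex_of_real (prob {\<omega>\<in>space M. \<forall>k\<in>S j. X j k \<omega> \<in> E j k})) * (CLINT \<omega>|M. iexp 0)"
      by (rule cylinder_factorization[OF mem orth J(3,2) SE(1-3) zero_mem]) auto
    then have eq: "(CLINT \<omega>|M. (\<Prod>j\<in>J. indicator (A j) \<omega>)) = (\<Prod>j\<in>J. complex_of_real (prob (A j)))"
      by (simp add: SE(4) prob_space cong: prod.cong)
    have "(\<Prod>j\<in>J. indicator (A j) \<omega>) = complex_of_real (indicator (\<Inter>j\<in>J. A j) \<omega>)" for \<omega>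
      using J(3) by (auto simp: indicator_def intro!: prod_zero)
    then have "(CLINT \<omega>|M. (\<Prod>j\<in>J. indicator (A j) \<omega>)) = complex_of_real (measure M ((\<Inter>j\<in>J. A j) \<inter> space M))"
      by simp
    also have "(\<Inter>j\<in>J. A j) \<inter> space M = (\<Inter>j\<in>J. A j)" using J(1) SE(4) by auto
    finally have "complex_of_real (prob (\<Inter>j\<in>J. A j)) = complex_of_real (\<Prod>j\<in>J. prob (A j))"
      using eq by simp
    then show "prob (\<Inter>j\<in>J. A j) = (\<Prod>j\<in>J. prob (A j))" using of_real_eq_iff by blast
  qed
  then have "indep_sets (\<lambda>i. sigma_sets (space M) (?F i)) I"
    by (rule indep_sets_sigma) (rule stable)
  then show ?thesis unfolding indep_vars_def2 gen using rv by auto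
qed

end

section \<open>The Wiener integral\<close>

text \<open>Gaussian white noise with a finite control measure \<open>C\<close>: jointly Gaussian variables, indexed by
  the measurable sets, whose covariance is the measure of the intersection.\<close>

locale white_noise = prob_space M + C: finite_measure C
  for M :: "'w measure" and C :: "'c measure" +
  fixes W :: "'c set \<Rightarrow> 'w \<Rightarrow> real"
  assumes jointly_gaussian: "jointly_centred_gaussian M (sets C) W"
    and covariance: "A \<in> sets C \<Longrightarrow> B \<in> sets C \<Longrightarrow> inner_L2 M (W A) (W B) = measure C (A \<inter> B)"
begin

text \<open>Step functions paired with their elementary integrals.\<close>

definition simple_pair :: "('c \<Rightarrow> real) \<Rightarrow> ('w \<Rightarrow> real) \<Rightarrow> bool" where
  "simple_pair g Y \<longleftrightarrow> (\<exists>F c. finite F \<and> F \<subseteq> sets C \<and>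
     g = (\<lambda>x. \<Sum>A\<in>F. c A * indicator A x) \<and> Y = (\<lambda>\<omega>. \<Sum>A\<in>F. c A * W A \<omega>))"

lemma simple_pair_gaussian: "simple_pair g Y \<Longrightarrow> centred_gaussian M Y"
  using jointly_gaussian by (auto simp: simple_pair_def jointly_centred_gaussian_def)

lemma simple_pair_sq_int:
  assumes "simple_pair g Y"
  shows "sq_int C g" "sq_int M Y"
proof -
  have "sq_int C (indicator A)" if "A \<in> sets C" for A
    using that by (intro C.sq_int_bounded[of _ 1]) (auto simp: indicator_def)
  then show "sq_int C g" using assms by (auto simp: simple_pair_def intro!: sq_int_sum sq_int_scale)
  show "sq_int M Y" using simple_pair_gaussian[OF assms] by (rule sq_int_centred_gaussian)
qed

lemma simple_pair_indicator:
  assumes "A \<in> sets C"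
  shows "simple_pair (indicator A) (W A)"
  unfolding simple_pair_def using assms by (intro exI[of _ "{A}"] exI[of _ "\<lambda>_. 1"]) auto

lemma simple_pair_zero: "simple_pair (\<lambda>_. 0) (\<lambda>_. 0)"
  unfolding simple_pair_def by (intro exI[of _ "{}"]) auto

lemma sq_int_W: "A \<in> sets C \<Longrightarrow> sq_int M (W A)"
  using simple_pair_sq_int(2)[OF simple_pair_indicator] .

lemma simple_pair_lin:
  assumes "simple_pair g Y" "simple_pair h Z"
  shows "simple_pair (\<lambda>x. g x + s * h x) (\<lambda>\<omega>. Y \<omega> + s * Z \<omega>)"
proof -
  obtain F c where F: "finite F" "F \<subseteq> sets C" "g = (\<lambda>x. \<Sum>A\<in>F. c A * indicator A x)"
    "Y = (\<lambda>\<omega>. \<Sum>A\<in>F. c A * W A \<omega>)" using assms(1) by (auto simp: simple_pair_def)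
  obtain G d where G: "finite G" "G \<subseteq> sets C" "h = (\<lambda>x. \<Sum>A\<in>G. d A * indicator A x)"
    "Z = (\<lambda>\<omega>. \<Sum>A\<in>G. d A * W A \<omega>)" using assms(2) by (auto simp: simple_pair_def)
  \<comment> \<open>Both combinations are rewritten over the common index set \<open>F \<union> G\<close>.\<close>
  define e where "e A = (if A \<in> F then c A else 0) + s * (if A \<in> G then d A else 0)" for A
  have key: "(\<Sum>A\<in>F. c A * u A) + s * (\<Sum>A\<in>G. d A * u A) = (\<Sum>A\<in>F \<union> G. e A * u A)" for u :: "'c set \<Rightarrow> real"
  proof -
    have "(\<Sum>A\<in>F. c A * u A) = (\<Sum>A\<in>F \<union> G. (if A \<in> F then c A else 0) * u A)"
      "(\<Sum>A\<in>G. d A * u A) = (\<Sum>A\<in>F \<union> G. (if A \<in> G then d A else 0) * u A)"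
      using F(1) G(1) by (auto intro!: sum.mono_neutral_cong_left)
    then show ?thesis
      by (simp add: e_def distrib_right sum.distrib sum_distrib_left mult.assoc)
  qed
  have "(\<lambda>x. g x + s * h x) = (\<lambda>x. \<Sum>A\<in>F \<union> G. e A * indicator A x)" unfolding F(3) G(3) by (intro ext key)
  moreover have "(\<lambda>\<omega>. Y \<omega> + s * Z \<omega>) = (\<lambda>\<omega>. \<Sum>A\<in>F \<union> G. e A * W A \<omega>)" unfolding F(4) G(4) by (intro ext key)
  moreover have "finite (F \<union> G)" "F \<union> G \<subseteq> sets C" using F(1,2) G(1,2) by auto
  ultimately show ?thesis unfolding simple_pair_def by blast
qed

lemma simple_pair_isometry:
  assumes "simple_pair g Y"
  shows "sqnorm M Y = sqnorm C g"
proof -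
  obtain F c where F: "finite F" "F \<subseteq> sets C" "g = (\<lambda>x. \<Sum>A\<in>F. c A * indicator A x)"
    "Y = (\<lambda>\<omega>. \<Sum>A\<in>F. c A * W A \<omega>)" using assms by (auto simp: simple_pair_def)
  have expand: "inner_L2 N (\<lambda>x. \<Sum>A\<in>F. c A * u A x) (\<lambda>x. \<Sum>A\<in>F. c A * u A x)
      = (\<Sum>A\<in>F. \<Sum>B\<in>F. c A * c B * inner_L2 N (u B) (u A))"
    if u: "\<And>A. A \<in> F \<Longrightarrow> sq_int N (u A)" for N :: "'x measure" and u
  proof -
    have sq: "sq_int N (\<lambda>x. c A * u A x)" if "A \<in> F" for A using u that by auto
    have "inner_L2 N (\<lambda>x. \<Sum>A\<in>F. c A * u A x) (\<lambda>x. \<Sum>A\<in>F. c A * u A x)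
      = (\<Sum>A\<in>F. inner_L2 N (\<lambda>x. c A * u A x) (\<lambda>x. \<Sum>A\<in>F. c A * u A x))"
      using sq by (intro inner_L2_sum sq_int_sum) auto
    also have "\<dots> = (\<Sum>A\<in>F. c A * inner_L2 N (\<lambda>x. \<Sum>A\<in>F. c A * u A x) (u A))"
      by (simp add: mult.assoc mult.commute[of "u _ _" "sum _ _"])
    also have "\<dots> = (\<Sum>A\<in>F. c A * (\<Sum>B\<in>F. inner_L2 N (\<lambda>x. c B * u B x) (u A)))"
      using sq u by (intro sum.cong refl arg_cong[where f = "(*) _"] inner_L2_sum) auto
    finally show ?thesis by (simp add: sum_distrib_left mult.assoc)
  qed
  have "sqnorm M Y = (\<Sum>A\<in>F. \<Sum>B\<in>F. c A * c B * inner_L2 M (W B) (W A))"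
    unfolding F(4) power2_eq_square using F(2) by (intro expand sq_int_W) auto
  also have "\<dots> = (\<Sum>A\<in>F. \<Sum>B\<in>F. c A * c B * inner_L2 C (indicator B) (indicator A))"
  proof (intro sum.cong refl)
    fix A B assume "A \<in> F" "B \<in> F"
    then have "A \<in> sets C" "B \<in> sets C" using F(2) by auto
    moreover from this have "(LINT x|C. indicator (B \<inter> A) x) = measure C (B \<inter> A)" by simp
    ultimately show "c A * c B * inner_L2 M (W B) (W A) = c A * c B * inner_L2 C (indicator B) (indicator A)"
      using covariance[of B A] by (simp only: indicator_inter_arith)
  qed
  also have "\<dots> = sqnorm C g"
    unfolding F(3) power2_eq_square using F(2) simple_pair_sq_int(1)[OF simple_pair_indicator]
    by (intro expand[symmetric]) auto
  finally show ?thesis .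
qed

text \<open>\<open>wiener_integral f X\<close>: the variable \<open>X\<close> is a version of the integral of \<open>f\<close> against \<open>W\<close>.  A
  relation, since such an \<open>X\<close> is unique only almost surely.\<close>

definition wiener_integral :: "('c \<Rightarrow> real) \<Rightarrow> ('w \<Rightarrow> real) \<Rightarrow> bool" where
  "wiener_integral f X \<longleftrightarrow> sq_int C f \<and> sq_int M X \<and> (\<exists>g Y. (\<forall>n::nat. simple_pair (g n) (Y n)) \<and>
     (\<lambda>n. sqnorm C (\<lambda>x. g n x - f x)) \<longlonglongrightarrow> 0 \<and> (\<lambda>n. sqnorm M (\<lambda>\<omega>. Y n \<omega> - X \<omega>)) \<longlonglongrightarrow> 0)"

lemma wiener_integralD:
  assumes "wiener_integral f X"
  shows "sq_int C f" "sq_int M X"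
  using assms by (auto simp: wiener_integral_def)

lemma wiener_integral_simple: "simple_pair f X \<Longrightarrow> wiener_integral f X"
  unfolding wiener_integral_def using simple_pair_sq_int
  by (auto intro!: exI[of _ "\<lambda>_. f"] exI[of _ "\<lambda>_. X"])

lemma wiener_integral_indicator: "A \<in> sets C \<Longrightarrow> wiener_integral (indicator A) (W A)"
  by (intro wiener_integral_simple simple_pair_indicator)

lemma wiener_integral_zero: "wiener_integral (\<lambda>_. 0) (\<lambda>_. 0)"
  by (intro wiener_integral_simple simple_pair_zero)

lemma wiener_integral_lin:
  assumes "wiener_integral f X" "wiener_integral g Y"
  shows "wiener_integral (\<lambda>x. f x + s * g x) (\<lambda>\<omega>. X \<omega> + s * Y \<omega>)"
proof -
  note sq = wiener_integralD[OF assms(1)] wiener_integralD[OF assms(2)]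
  obtain f' X' where 1: "\<And>n. simple_pair (f' n) (X' n)"
    "(\<lambda>n. sqnorm C (\<lambda>x. f' n x - f x)) \<longlonglongrightarrow> 0" "(\<lambda>n. sqnorm M (\<lambda>\<omega>. X' n \<omega> - X \<omega>)) \<longlonglongrightarrow> 0"
    using assms(1) by (auto simp: wiener_integral_def)
  obtain g' Y' where 2: "\<And>n. simple_pair (g' n) (Y' n)"
    "(\<lambda>n. sqnorm C (\<lambda>x. g' n x - g x)) \<longlonglongrightarrow> 0" "(\<lambda>n. sqnorm M (\<lambda>\<omega>. Y' n \<omega> - Y \<omega>)) \<longlonglongrightarrow> 0"
    using assms(2) by (auto simp: wiener_integral_def)
  have lim: "(\<lambda>n. sqnorm N (\<lambda>x. (u' n x + s * v' n x) - (u x + s * v x))) \<longlonglongrightarrow> 0"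
    if "\<And>n. sq_int N (u' n)" "\<And>n. sq_int N (v' n)" "sq_int N u" "sq_int N v"
      "(\<lambda>n. sqnorm N (\<lambda>x. u' n x - u x)) \<longlonglongrightarrow> 0" "(\<lambda>n. sqnorm N (\<lambda>x. v' n x - v x)) \<longlonglongrightarrow> 0"
    for N :: "'x measure" and u' v' :: "nat \<Rightarrow> 'x \<Rightarrow> real" and u v
  proof (rule Lim_null_comparison)
    show "\<forall>\<^sub>F n in sequentially. norm (sqnorm N (\<lambda>x. (u' n x + s * v' n x) - (u x + s * v x)))
      \<le> 2 * sqnorm N (\<lambda>x. u' n x - u x) + 2 * (s\<^sup>2 * sqnorm N (\<lambda>x. v' n x - v x))"
    proof (intro always_eventually allI)
      fix n
      have eq: "(u' n x + s * v' n x) - (u x + s * v x) = (u' n x - u x) + s * (v' n x - v x)" for x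
        by (simp add: algebra_simps)
      have "sqnorm N (\<lambda>x. (u' n x + s * v' n x) - (u x + s * v x))
        \<le> 2 * sqnorm N (\<lambda>x. u' n x - u x) + 2 * sqnorm N (\<lambda>x. s * (v' n x - v x))"
        unfolding eq by (intro sqnorm_add_le sq_int_scale sq_int_diff that)
      then show "norm (sqnorm N (\<lambda>x. (u' n x + s * v' n x) - (u x + s * v x)))
        \<le> 2 * sqnorm N (\<lambda>x. u' n x - u x) + 2 * (s\<^sup>2 * sqnorm N (\<lambda>x. v' n x - v x))"
        unfolding sqnorm_scale real_norm_def abs_of_nonneg[OF sqnorm_nonneg] .
    qed
    have "(\<lambda>n. 2 * sqnorm N (\<lambda>x. u' n x - u x) + 2 * (s\<^sup>2 * sqnorm N (\<lambda>x. v' n x - v x)))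
      \<longlonglongrightarrow> 2 * 0 + 2 * (s\<^sup>2 * 0)" by (intro tendsto_intros that)
    then show "(\<lambda>n. 2 * sqnorm N (\<lambda>x. u' n x - u x) + 2 * (s\<^sup>2 * sqnorm N (\<lambda>x. v' n x - v x)))
      \<longlonglongrightarrow> 0" by simp
  qed
  show ?thesis unfolding wiener_integral_def
    using sq 1(1) 2(1) lim[OF simple_pair_sq_int(1)[OF 1(1)] simple_pair_sq_int(1)[OF 2(1)] sq(1,3) 1(2) 2(2)]
      lim[OF simple_pair_sq_int(2)[OF 1(1)] simple_pair_sq_int(2)[OF 2(1)] sq(2,4) 1(3) 2(3)]
    by (intro conjI sq_int_add sq_int_scale exI[of _ "\<lambda>n x. f' n x + s * g' n x"]
        exI[of _ "\<lambda>n \<omega>. X' n \<omega> + s * Y' n \<omega>"] allI simple_pair_lin) auto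
qed

lemma wiener_integral_sum:
  assumes "\<And>i. i \<in> I \<Longrightarrow> wiener_integral (f i) (X i)"
  shows "wiener_integral (\<lambda>x. \<Sum>i\<in>I. c i * f i x) (\<lambda>\<omega>. \<Sum>i\<in>I. c i * X i \<omega>)"
  using assms
proof (induction I rule: infinite_finite_induct)
  case (insert i I)
  then show ?case using wiener_integral_lin[of "\<lambda>x. \<Sum>i\<in>I. c i * f i x" "\<lambda>\<omega>. \<Sum>i\<in>I. c i * X i \<omega>" "f i" "X i" "c i"]
    by (simp add: add.commute)
qed (auto intro: wiener_integral_zero)

lemma wiener_integral_isometry:
  assumes "wiener_integral f X"
  shows "sqnorm M X = sqnorm C f"
proof -
  obtain g Y where 1: "\<And>n. simple_pair (g n) (Y n)"
    "(\<lambda>n. sqnorm C (\<lambda>x. g n x - f x)) \<longlonglongrightarrow> 0" "(\<lambda>n. sqnorm M (\<lambda>\<omega>. Y n \<omega> - X \<omega>)) \<longlonglongrightarrow> 0"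
    using assms by (auto simp: wiener_integral_def)
  have "(\<lambda>n. sqnorm C (g n)) \<longlonglongrightarrow> sqnorm C f"
    by (intro sqnorm_tendsto 1 wiener_integralD[OF assms] simple_pair_sq_int(1)[OF 1(1)])
  moreover have "(\<lambda>n. sqnorm M (Y n)) \<longlonglongrightarrow> sqnorm M X"
    by (intro sqnorm_tendsto 1 wiener_integralD[OF assms] simple_pair_sq_int(2)[OF 1(1)])
  ultimately show ?thesis using simple_pair_isometry[OF 1(1)] LIMSEQ_unique by fastforce
qed

lemma wiener_integral_inner:
  assumes "wiener_integral f X" "wiener_integral g Y"
  shows "inner_L2 M X Y = inner_L2 C f g"
proof -
  note sq = wiener_integralD[OF assms(1)] wiener_integralD[OF assms(2)]
  have "sqnorm M (\<lambda>\<omega>. X \<omega> + Y \<omega>) = sqnorm C (\<lambda>x. f x + g x)"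
    using wiener_integral_isometry[OF wiener_integral_lin[OF assms, of 1]] by simp
  then show ?thesis
    using sqnorm_add[OF sq(1,3)] sqnorm_add[OF sq(2,4)] wiener_integral_isometry[OF assms(1)]
      wiener_integral_isometry[OF assms(2)] by simp
qed

lemma wiener_integral_unique:
  assumes "wiener_integral f X" "wiener_integral g Y" "\<And>x. x \<in> space C \<Longrightarrow> f x = g x"
  shows "AE \<omega> in M. X \<omega> = Y \<omega>"
proof -
  have L: "wiener_integral (\<lambda>x. f x + (-1) * g x) (\<lambda>\<omega>. X \<omega> + (-1) * Y \<omega>)"
    by (rule wiener_integral_lin[OF assms(1,2)])
  have "sqnorm C (\<lambda>x. f x + (-1) * g x) = (LINT x|C. 0)"
    using assms(3) by (intro Bochner_Integration.integral_cong) auto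
  then have "sqnorm M (\<lambda>\<omega>. X \<omega> + (-1) * Y \<omega>) = 0"
    using wiener_integral_isometry[OF L] by simp
  then show ?thesis using sqnorm_zero_AE[OF wiener_integralD(2)[OF L]] by simp
qed

lemma wiener_integral_gaussian:
  assumes "wiener_integral f X"
  shows "centred_gaussian M X"
proof -
  obtain g Y where 1: "\<And>n. simple_pair (g n) (Y n)" "(\<lambda>n. sqnorm M (\<lambda>\<omega>. Y n \<omega> - X \<omega>)) \<longlonglongrightarrow> 0"
    using assms by (auto simp: wiener_integral_def)
  show ?thesis
    by (rule centred_gaussian_L2_limit[OF simple_pair_gaussian[OF 1(1)] wiener_integralD(2)[OF assms] 1(2)])
qed

lemma gaussian_space_wiener_integrals: "gaussian_space M {X. \<exists>f. wiener_integral f X}"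
  by unfold_locales (use wiener_integral_gaussian wiener_integral_zero wiener_integral_lin in blast)+

text \<open>Simple functions dominated by \<open>2|f|\<close> converge to \<open>f\<close> in \<open>L\<^sup>2\<close>; each agrees on the
  space with a step function.\<close>

lemma simple_pair_dense:
  assumes f: "sq_int C f" and e: "e > 0"
  obtains g Y where "simple_pair g Y" "sqnorm C (\<lambda>x. g x - f x) < e"
proof -
  have fm [measurable]: "f \<in> borel_measurable C" using f by auto
  from borel_measurable_implies_sequence_metric[OF fm, of 0] obtain s where
    "\<forall>i. simple_function C (s i)" "\<forall>x\<in>space C. (\<lambda>i. s i x) \<longlonglongrightarrow> f x"
    "\<forall>i. \<forall>x\<in>space C. \<bar>s i x\<bar> \<le> 2 * \<bar>f x\<bar>"
    by (auto simp: dist_real_def)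
  then have s: "\<And>i. simple_function C (s i)" "\<And>x. x \<in> space C \<Longrightarrow> (\<lambda>i. s i x) \<longlonglongrightarrow> f x"
    "\<And>i x. x \<in> space C \<Longrightarrow> \<bar>s i x\<bar> \<le> 2 * \<bar>f x\<bar>"
    by auto
  have sm [measurable]: "s i \<in> borel_measurable C" for i
    using s(1) by (rule borel_measurable_simple_function)
  have "(\<lambda>i. LINT x|C. (s i x - f x)\<^sup>2) \<longlonglongrightarrow> (LINT x|C. 0)"
  proof (rule integral_dominated_convergence)
    show "integrable C (\<lambda>x. 9 * (f x)\<^sup>2)" using f by auto
    show "AE x in C. (\<lambda>i. (s i x - f x)\<^sup>2) \<longlonglongrightarrow> 0"
    proof (intro AE_I2)
      fix x assume "x \<in> space C"
      then have "(\<lambda>i. (s i x - f x)\<^sup>2) \<longlonglongrightarrow> (f x - f x)\<^sup>2" by (intro tendsto_intros s(2))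
      then show "(\<lambda>i. (s i x - f x)\<^sup>2) \<longlonglongrightarrow> 0" by simp
    qed
    show "AE x in C. norm ((s i x - f x)\<^sup>2) \<le> 9 * (f x)\<^sup>2" for i
    proof (intro AE_I2)
      fix x assume "x \<in> space C"
      then have "\<bar>s i x - f x\<bar> \<le> 3 * \<bar>f x\<bar>" using s(3)[of x i] by linarith
      then have "\<bar>s i x - f x\<bar>\<^sup>2 \<le> (3 * \<bar>f x\<bar>)\<^sup>2" by (intro power_mono) auto
      then show "norm ((s i x - f x)\<^sup>2) \<le> 9 * (f x)\<^sup>2" by (simp add: power_mult_distrib)
    qed
  qed auto
  then have "\<forall>\<^sub>F i in sequentially. sqnorm C (\<lambda>x. s i x - f x) < e"
    using e by (intro order_tendstoD(2)) auto
  then obtain i where i: "sqnorm C (\<lambda>x. s i x - f x) < e" by (auto simp: eventually_sequentially)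
  let ?A = "\<lambda>y. s i -` {y} \<inter> space C"
  have partial: "simple_pair (\<lambda>x. \<Sum>y\<in>T. y * indicator (?A y) x) (\<lambda>\<omega>. \<Sum>y\<in>T. y * W (?A y) \<omega>)"
    if "finite T" "T \<subseteq> s i ` space C" for T
    using that
  proof (induction T rule: finite_induct)
    case (insert y T)
    have "?A y \<in> sets C" using s(1)[of i] by (rule simple_functionD)
    moreover have "simple_pair (\<lambda>x. \<Sum>y\<in>T. y * indicator (?A y) x) (\<lambda>\<omega>. \<Sum>y\<in>T. y * W (?A y) \<omega>)"
      using insert by simp
    ultimately have "simple_pair (\<lambda>x. (\<Sum>y\<in>T. y * indicator (?A y) x) + y * indicator (?A y) x)
        (\<lambda>\<omega>. (\<Sum>y\<in>T. y * W (?A y) \<omega>) + y * W (?A y) \<omega>)"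
      by (intro simple_pair_lin simple_pair_indicator)
    then show ?case by (simp only: sum.insert[OF insert.hyps(1,2)] add.commute)
  qed (simp add: simple_pair_zero)
  have pair: "simple_pair (\<lambda>x. \<Sum>y\<in>s i ` space C. y * indicator (?A y) x)
      (\<lambda>\<omega>. \<Sum>y\<in>s i ` space C. y * W (?A y) \<omega>)"
    by (rule partial[OF simple_functionD(1)[OF s(1)[of i]] subset_refl])
  have "sqnorm C (\<lambda>x. (\<Sum>y\<in>s i ` space C. y * indicator (?A y) x) - f x) = sqnorm C (\<lambda>x. s i x - f x)"
  proof (intro Bochner_Integration.integral_cong refl)
    fix x assume "x \<in> space C"
    from simple_function_indicator_representation_banach[OF s(1)[of i] this]
    have "(\<Sum>y\<in>s i ` space C. y * indicator (?A y) x) = s i x"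
      by (simp only: real_scaleR_def mult.commute)
    then show "((\<Sum>y\<in>s i ` space C. y * indicator (?A y) x) - f x)\<^sup>2 = (s i x - f x)\<^sup>2"
      by (simp only:)
  qed
  with i have "sqnorm C (\<lambda>x. (\<Sum>y\<in>s i ` space C. y * indicator (?A y) x) - f x) < e"
    by (simp only:)
  with pair show thesis by (rule that)
qed

text \<open>Step functions approximating \<open>f\<close> at a geometric rate have elementary integrals that are Cauchy
  at that rate, by the isometry.\<close>

lemma wiener_integral_exists:
  assumes f: "sq_int C f"
  shows "\<exists>X. wiener_integral f X"
proof -
  have "\<exists>g Y. simple_pair g Y \<and> sqnorm C (\<lambda>x. g x - f x) < (1/4)^n / 2" for n
  proof -
    have "(0::real) < (1/4)^n / 2" by simp
    from simple_pair_dense[OF f this] show ?thesis by blast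
  qed
  then have "\<forall>n. \<exists>g. \<exists>Y. simple_pair g Y \<and> sqnorm C (\<lambda>x. g x - f x) < (1/4)^n / 2" by blast
  from choice[OF this] obtain g where "\<forall>n. \<exists>Y. simple_pair (g n) Y \<and> sqnorm C (\<lambda>x. g n x - f x) < (1/4)^n / 2"
    by blast
  from choice[OF this] obtain Y where gY: "\<And>n. simple_pair (g n) (Y n)"
    "\<And>n. sqnorm C (\<lambda>x. g n x - f x) < (1/4)^n / 2" by blast
  note sq = simple_pair_sq_int[OF gY(1)]
  have cauchy: "sqnorm M (\<lambda>\<omega>. Y n \<omega> - Y m \<omega>) \<le> (1/4)^n + (1/4)^m" for n m
  proof -
    have "sqnorm M (\<lambda>\<omega>. Y n \<omega> - Y m \<omega>) = sqnorm C (\<lambda>x. g n x - g m x)"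
      using simple_pair_isometry[OF simple_pair_lin[OF gY(1) gY(1), of n "-1" m]] by simp
    also have "\<dots> \<le> 2 * sqnorm C (\<lambda>x. g n x - f x) + 2 * sqnorm C (\<lambda>x. f x - g m x)"
      by (intro sqnorm_triangle sq f)
    also have "\<dots> \<le> (1/4)^n + (1/4)^m"
      using gY(2)[of n] gY(2)[of m] sqnorm_diff_commute[of C f "g m"] by simp
    finally show ?thesis .
  qed
  obtain X where X: "sq_int M X" "(\<lambda>n. sqnorm M (\<lambda>\<omega>. Y n \<omega> - X \<omega>)) \<longlonglongrightarrow> 0"
    using L2_complete[OF sq(2) cauchy] .
  have "(\<lambda>n. sqnorm C (\<lambda>x. g n x - f x)) \<longlonglongrightarrow> 0"
  proof (rule Lim_null_comparison)
    show "\<forall>\<^sub>F n in sequentially. norm (sqnorm C (\<lambda>x. g n x - f x)) \<le> (1/4)^n"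
    proof (intro always_eventually allI)
      fix n
      have "(0::real) \<le> (1/4)^n" by simp
      then show "norm (sqnorm C (\<lambda>x. g n x - f x)) \<le> (1/4)^n"
        using gY(2)[of n] sqnorm_nonneg[of C "\<lambda>x. g n x - f x"] unfolding real_norm_def by linarith
    qed
  qed (rule LIMSEQ_realpow_zero; simp)
  then show ?thesis using f X gY(1) unfolding wiener_integral_def by blast
qed

end

section \<open>Lebesgue measure on the cube\<close>

abbreviation (input) unit_lborel :: "real measure" where
  "unit_lborel \<equiv> restrict_space lborel {0..1}"

text \<open>Lebesgue measure on \<open>[0,1]\<^sup>J\<close>.  Its \<open>\<sigma>\<close>-algebra is that of \<^const>\<open>unit_cube\<close>.\<close>

definition leb_cube :: "'i set \<Rightarrow> ('i \<Rightarrow> real) measure" where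
  "leb_cube J = (\<Pi>\<^sub>M j\<in>J. unit_lborel)"

lemma prob_space_unit_lborel: "prob_space unit_lborel"
  by (rule prob_spaceI) (simp add: emeasure_restrict_space space_restrict_space)

lemma measure_unit_lborel:
  "A \<in> sets borel \<Longrightarrow> A \<subseteq> {0..1} \<Longrightarrow> measure unit_lborel A = measure lborel A"
  by (simp add: measure_restrict_space)

lemma prob_space_leb_cube: "prob_space (leb_cube J)"
  unfolding leb_cube_def by (rule prob_space_PiM) (rule prob_space_unit_lborel)

lemma sets_leb_cube: "sets (leb_cube J) = sets (unit_cube J)"
  unfolding leb_cube_def unit_cube_def by (intro sets_PiM_cong refl sets_restrict_space_cong) simp

lemma space_leb_cube: "space (leb_cube J) = (\<Pi>\<^sub>E j\<in>J. {0..1})"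
  by (simp add: leb_cube_def space_PiM space_restrict_space)

lemma space_unit_cube: "space (unit_cube J) = (\<Pi>\<^sub>E j\<in>J. {0..1})"
  by (simp add: unit_cube_def space_PiM space_restrict_space)

lemma sets_unit_lborel_iff: "A \<in> sets unit_lborel \<longleftrightarrow> A \<in> sets borel \<and> A \<subseteq> {0..1}"
  by (subst sets_restrict_space_iff) auto

lemma sets_box: "finite H \<Longrightarrow> borel_box H A \<Longrightarrow> PiE H A \<in> sets (unit_cube H)"
  unfolding sets_leb_cube[symmetric] leb_cube_def
  by (intro sets_PiM_I_finite) (auto simp: borel_box_def sets_unit_lborel_iff)

lemma measure_box:
  assumes "finite J" "borel_box J A"
  shows "measure (leb_cube J) (PiE J A) = (\<Prod>j\<in>J. measure lborel (A j))"
proof -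
  interpret prob_space unit_lborel by (rule prob_space_unit_lborel)
  interpret product_sigma_finite "\<lambda>_. unit_lborel" by unfold_locales
  have "emeasure (leb_cube J) (PiE J A) = (\<Prod>j\<in>J. emeasure unit_lborel (A j))"
    unfolding leb_cube_def using assms
    by (intro emeasure_PiM) (auto simp: borel_box_def sets_unit_lborel_iff)
  also have "\<dots> = (\<Prod>j\<in>J. ennreal (measure lborel (A j)))"
    using assms measure_unit_lborel by (intro prod.cong refl) (simp add: borel_box_def emeasure_eq_measure)
  also have "\<dots> = ennreal (\<Prod>j\<in>J. measure lborel (A j))" by (intro prod_ennreal) auto
  finally show ?thesis by (simp add: measure_def prod_nonneg)
qed

text \<open>The \<open>\<pi>\<close>-\<open>\<lambda>\<close> argument, for real-valued countably additive set functions.\<close>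

lemma additive_zero_if_zero_on_boxes:
  fixes F :: "('i \<Rightarrow> real) set \<Rightarrow> real"
  assumes additive: "\<And>A. range A \<subseteq> sets (unit_cube H) \<Longrightarrow> disjoint_family A \<Longrightarrow>
      (\<lambda>i::nat. F (A i)) sums F (\<Union>i. A i)"
    and box: "\<And>A. borel_box H A \<Longrightarrow> F (PiE H A) = 0"
    and A: "A \<in> sets (unit_cube H)"
  shows "F A = 0"
proof -
  let ?U = "restrict_space borel {0..1::real}"
  let ?\<Omega> = "\<Pi>\<^sub>E j\<in>H. space ?U"
  let ?P = "prod_algebra H (\<lambda>_. ?U)"
  have gen: "sets (unit_cube H) = sigma_sets ?\<Omega> ?P" unfolding unit_cube_def by (rule sets_PiM)
  have "(\<lambda>i::nat. F {}) sums F (\<Union>i::nat. {})"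
    by (rule additive) (auto simp: disjoint_family_on_def)
  then have "summable (\<lambda>i::nat. F {})" by (rule sums_summable)
  then have "(\<lambda>i::nat. F {}) \<longlonglongrightarrow> 0" by (rule summable_LIMSEQ_zero)
  then have F0: "F {} = 0" by (simp only: LIMSEQ_const_iff)
  have "A \<in> sigma_sets ?\<Omega> ?P" using A gen by simp
  with Int_stable_prod_algebra prod_algebra_sets_into_space show ?thesis
  proof (induction rule: sigma_sets_induct_disjoint)
    case (basic A)
    then obtain E where "A = PiE H E" "E \<in> (\<Pi> j\<in>H. sets ?U)" by (rule prod_algebraE_all)
    then show ?case by (auto intro!: box simp: borel_box_def sets_restrict_space_iff Pi_iff)
  next
    case empty
    show ?case by (rule F0)
  next
    case (compl A)
    then have A: "A \<in> sets (unit_cube H)" using gen by simp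
    have sp: "?\<Omega> = space (unit_cube H)" by (simp add: space_unit_cube space_restrict_space)
    let ?B = "binaryset A (?\<Omega> - A)"
    have 1: "(\<lambda>i. F (?B i)) sums F (\<Union>i. ?B i)"
      using A unfolding sp by (intro additive) (auto simp: range_binaryset_eq disjoint_family_on_def binaryset_def)
    have 2: "(\<lambda>i. F (?B i)) sums (F A + F (?\<Omega> - A))"
      by (rule binaryset_sums) (rule F0)
    have 3: "(\<Union>i. ?B i) = ?\<Omega>" using sets.sets_into_space[OF A] sp by (auto simp: UN_binaryset_eq)
    have 4: "F ?\<Omega> = 0" by (rule box) (auto simp: borel_box_def space_restrict_space)
    have "F A + F (?\<Omega> - A) = 0" using sums_unique2[OF 2 1] unfolding 3 4 .
    with compl.IH show ?case by linarith
  next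
    case (union A)
    then have 1: "(\<lambda>i. F (A i)) sums F (\<Union>i. A i)" using gen by (intro additive) auto
    have 2: "(\<lambda>i. F (A i)) sums 0" unfolding union.IH by (rule sums_zero)
    show ?case by (rule sums_unique2[OF 1 2])
  qed
qed

lemma inner_L2_sums:
  fixes u :: "nat \<Rightarrow> 'a \<Rightarrow> real"
  assumes u: "\<And>i. sq_int N (u i)" and U: "sq_int N U" and g: "sq_int N g"
    and lim: "(\<lambda>n. sqnorm N (\<lambda>x. U x - (\<Sum>i<n. u i x))) \<longlonglongrightarrow> 0"
  shows "(\<lambda>i. inner_L2 N (u i) g) sums inner_L2 N U g"
proof -
  have "(\<lambda>n. inner_L2 N (\<lambda>x. \<Sum>i<n. u i x) g) \<longlonglongrightarrow> inner_L2 N U g"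
    using lim by (intro inner_L2_tendsto sq_int_sum u U g) (simp add: power2_commute)
  then show ?thesis unfolding sums_def by (simp only: inner_L2_sum[OF u g])
qed

lemma (in prob_space) gaussian_measure_sq_int:
  assumes "gaussian_measure M H m" "A \<in> sets (unit_cube H)"
  shows "sq_int M (m A)"
proof -
  have "jointly_centred_gaussian M (sets (unit_cube H)) m" using assms(1) by (simp add: gaussian_measure_def)
  from this[unfolded jointly_centred_gaussian_def, rule_format, of "{A}" "\<lambda>_. 1"]
  have "centred_gaussian M (\<lambda>\<omega>. \<Sum>k\<in>{A}. 1 * m k \<omega>)" using assms(2) by simp
  from sq_int_centred_gaussian[OF this] show ?thesis by simp
qed

lemma (in prob_space) gaussian_measure_inner_sums:
  assumes m: "gaussian_measure M H m" and A: "range A \<subseteq> sets (unit_cube H)" "disjoint_family A"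
    and Y: "sq_int M Y"
  shows "(\<lambda>i. inner_L2 M (m (A i)) Y) sums inner_L2 M (m (\<Union>i. A i)) Y"
proof (rule inner_L2_sums)
  show "sq_int M (m (A i))" for i using A by (intro gaussian_measure_sq_int[OF m]) auto
  show "sq_int M (m (\<Union>i. A i))" using A by (intro gaussian_measure_sq_int[OF m] sets.countable_UN) auto
  show "(\<lambda>n. sqnorm M (\<lambda>x. m (\<Union>i. A i) x - (\<Sum>i<n. m (A i) x))) \<longlonglongrightarrow> 0"
    using m A unfolding gaussian_measure_def by blast
qed fact

text \<open>The covariance, prescribed on boxes, extends to all Borel sets.\<close>

lemma wiener_white_noise:
  assumes M: "prob_space M" and W: "wiener_measure M p W"
  shows "white_noise M (leb_cube {1..p}) W"
proof -
  let ?J = "{1..p}"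
  interpret prob_space M by (rule M)
  interpret C: prob_space "leb_cube ?J" by (rule prob_space_leb_cube)
  have G: "gaussian_measure M ?J W" using W by (simp add: wiener_measure_def)
  have box: "inner_L2 M (W (PiE ?J A)) (W (PiE ?J B)) = measure (leb_cube ?J) (PiE ?J A \<inter> PiE ?J B)"
    if "borel_box ?J A" "borel_box ?J B" for A B
  proof -
    have "borel_box ?J (\<lambda>j. A j \<inter> B j)" using that by (auto simp: borel_box_def)
    then have "measure (leb_cube ?J) (PiE ?J A \<inter> PiE ?J B) = (\<Prod>j\<in>?J. measure lborel (A j \<inter> B j))"
      unfolding PiE_Int by (intro measure_box) auto
    then show ?thesis using W that by (simp add: wiener_measure_def)
  qed
  have add: "(\<lambda>i. inner_L2 M (W (A i)) (W B) - measure (leb_cube ?J) (A i \<inter> B)) sums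
      (inner_L2 M (W (\<Union>i. A i)) (W B) - measure (leb_cube ?J) ((\<Union>i. A i) \<inter> B))"
    if A: "range A \<subseteq> sets (unit_cube ?J)" "disjoint_family A" and B: "B \<in> sets (unit_cube ?J)" for A :: "nat \<Rightarrow> _" and B
  proof (rule sums_diff)
    show "(\<lambda>i. inner_L2 M (W (A i)) (W B)) sums inner_L2 M (W (\<Union>i. A i)) (W B)"
      by (rule gaussian_measure_inner_sums[OF G A gaussian_measure_sq_int[OF G B]])
    have "(\<lambda>i. measure (leb_cube ?J) (A i \<inter> B)) sums measure (leb_cube ?J) (\<Union>i. A i \<inter> B)"
      using A B by (intro C.finite_measure_UNION) (auto simp: sets_leb_cube disjoint_family_on_def)
    then show "(\<lambda>i. measure (leb_cube ?J) (A i \<inter> B)) sums measure (leb_cube ?J) ((\<Union>i. A i) \<inter> B)"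
      by simp
  qed
  \<comment> \<open>Used twice: first with \<open>B\<close> a box, then, by symmetry of the covariance, with \<open>B\<close> arbitrary.\<close>
  have step: "inner_L2 M (W A) (W B) - measure (leb_cube ?J) (A \<inter> B) = 0"
    if "A \<in> sets (unit_cube ?J)" "B \<in> sets (unit_cube ?J)"
      "\<And>X. borel_box ?J X \<Longrightarrow> inner_L2 M (W (PiE ?J X)) (W B) = measure (leb_cube ?J) (PiE ?J X \<inter> B)" for A B
    by (rule additive_zero_if_zero_on_boxes[OF add[OF _ _ that(2)] _ that(1)]) (use that(3) in simp_all)
  have half: "inner_L2 M (W A) (W (PiE ?J X)) = measure (leb_cube ?J) (A \<inter> PiE ?J X)"
    if "A \<in> sets (unit_cube ?J)" "borel_box ?J X" for A X
    using step[OF that(1) sets_box[OF _ that(2)]] box that(2) by simp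
  have "inner_L2 M (W A) (W B) = measure (leb_cube ?J) (A \<inter> B)"
    if "A \<in> sets (unit_cube ?J)" "B \<in> sets (unit_cube ?J)" for A B
    using step[OF that] half[OF that(2)] by (simp add: Int_commute mult.commute)
  then show ?thesis
    using G by unfold_locales (auto simp: sets_leb_cube gaussian_measure_def)
qed

section \<open>The integrands of the pillows\<close>

text \<open>The point of \<open>[0,1]\<^sup>H\<close> with the coordinates of \<open>x\<close> on \<open>G\<close> and those of \<open>y\<close> elsewhere.\<close>

definition mix :: "'i set \<Rightarrow> 'i set \<Rightarrow> ('i \<Rightarrow> real) \<Rightarrow> ('i \<Rightarrow> real) \<Rightarrow> 'i \<Rightarrow> real" where
  "mix H G x y = (\<lambda>j\<in>H. if j \<in> G then x j else y j)"

text \<open>The probability that \<open>A\<close> is hit when the coordinates in \<open>G\<close> are frozen at \<open>x\<close> and those in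
  \<open>H - G\<close> are uniform and independent.  All of \<open>[0,1]\<^sup>J\<close> serves as sample space, so that the
  measure does not depend on \<open>G\<close>.\<close>

definition section_measure :: "'i set \<Rightarrow> 'i set \<Rightarrow> 'i set \<Rightarrow> ('i \<Rightarrow> real) set \<Rightarrow> ('i \<Rightarrow> real) \<Rightarrow> real" where
  "section_measure J H G A x = measure (leb_cube J) {y \<in> space (leb_cube J). mix H G x y \<in> A}"

text \<open>The integrand of the pillow \<open>b\<^sub>H(A)\<close>: inclusion-exclusion over the frozen coordinates, that is,
  the measure of \<open>A\<close> under \<open>\<Otimes>\<^bsub>j\<in>H\<^esub> (\<delta>\<^bsub>x\<^sub>j\<^esub> - \<lambda>)\<close>.\<close>

definition pillow_fun :: "'i set \<Rightarrow> 'i set \<Rightarrow> ('i \<Rightarrow> real) set \<Rightarrow> ('i \<Rightarrow> real) \<Rightarrow> real" where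
  "pillow_fun J H A x = (\<Sum>G\<in>Pow H. (-1) ^ (card H - card G) * section_measure J H G A x)"

lemma measurable_mix_pair:
  assumes "H \<subseteq> J"
  shows "(\<lambda>(x, y). mix H G x y) \<in> leb_cube J \<Otimes>\<^sub>M leb_cube J \<rightarrow>\<^sub>M leb_cube H"
proof -
  have "(\<lambda>p. \<lambda>j\<in>H. if j \<in> G then fst p j else snd p j) \<in> leb_cube J \<Otimes>\<^sub>M leb_cube J \<rightarrow>\<^sub>M leb_cube H"
    unfolding leb_cube_def
  proof (rule measurable_restrict)
    fix j assume "j \<in> H"
    then have j: "j \<in> J" using assms by auto
    have "(\<lambda>p. fst p j) \<in> Pi\<^sub>M J (\<lambda>_. unit_lborel) \<Otimes>\<^sub>M Pi\<^sub>M J (\<lambda>_. unit_lborel) \<rightarrow>\<^sub>M unit_lborel"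
      "(\<lambda>p. snd p j) \<in> Pi\<^sub>M J (\<lambda>_. unit_lborel) \<Otimes>\<^sub>M Pi\<^sub>M J (\<lambda>_. unit_lborel) \<rightarrow>\<^sub>M unit_lborel"
      by (rule measurable_compose[OF measurable_fst measurable_component_singleton[OF j]],
          rule measurable_compose[OF measurable_snd measurable_component_singleton[OF j]])
    then show "(\<lambda>p. if j \<in> G then fst p j else snd p j)
      \<in> Pi\<^sub>M J (\<lambda>_. unit_lborel) \<Otimes>\<^sub>M Pi\<^sub>M J (\<lambda>_. unit_lborel) \<rightarrow>\<^sub>M unit_lborel"
      by (cases "j \<in> G") simp_all
  qed
  then show ?thesis by (simp add: mix_def case_prod_beta')
qed

lemma sets_section:
  assumes "H \<subseteq> J" "A \<in> sets (unit_cube H)" "x \<in> space (leb_cube J)"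
  shows "{y \<in> space (leb_cube J). mix H G x y \<in> A} \<in> sets (leb_cube J)"
proof -
  have "(\<lambda>y. mix H G x y) \<in> leb_cube J \<rightarrow>\<^sub>M leb_cube H"
    using measurable_Pair2[OF measurable_mix_pair[OF assms(1)] assms(3)] by simp
  from measurable_sets[OF this, of A] show ?thesis
    using assms(2) by (simp add: sets_leb_cube vimage_def Int_def conj_commute)
qed

lemma measurable_section_measure:
  assumes "H \<subseteq> J" "A \<in> sets (unit_cube H)"
  shows "section_measure J H G A \<in> borel_measurable (leb_cube J)"
proof -
  interpret prob_space "leb_cube J" by (rule prob_space_leb_cube)
  let ?Q = "(\<lambda>(x, y). mix H G x y) -` A \<inter> space (leb_cube J \<Otimes>\<^sub>M leb_cube J)"
  have "?Q \<in> sets (leb_cube J \<Otimes>\<^sub>M leb_cube J)"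
    using assms(2) by (intro measurable_sets[OF measurable_mix_pair[OF assms(1)]]) (simp add: sets_leb_cube)
  then have "(\<lambda>x. enn2real (emeasure (leb_cube J) (Pair x -` ?Q))) \<in> borel_measurable (leb_cube J)"
    by (intro borel_measurable_enn2real measurable_emeasure_Pair)
  moreover have "section_measure J H G A x = enn2real (emeasure (leb_cube J) (Pair x -` ?Q))"
    if "x \<in> space (leb_cube J)" for x
  proof -
    have "Pair x -` ?Q = {y \<in> space (leb_cube J). mix H G x y \<in> A}"
      using that by (auto simp: space_pair_measure)
    then show ?thesis by (simp add: section_measure_def measure_def)
  qed
  ultimately show ?thesis by (simp cong: measurable_cong)
qed

lemma section_measure_bounds: "0 \<le> section_measure J H G A x" "section_measure J H G A x \<le> 1"
  using prob_space.prob_le_1[OF prob_space_leb_cube] by (auto simp: section_measure_def)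

lemma section_measure_sums:
  assumes "H \<subseteq> J" "range A \<subseteq> sets (unit_cube H)" "disjoint_family A" "x \<in> space (leb_cube J)"
  shows "(\<lambda>i. section_measure J H G (A i) x) sums section_measure J H G (\<Union>i. A i) x"
proof -
  interpret prob_space "leb_cube J" by (rule prob_space_leb_cube)
  let ?S = "\<lambda>i. {y \<in> space (leb_cube J). mix H G x y \<in> A i}"
  have "(\<lambda>i. measure (leb_cube J) (?S i)) sums measure (leb_cube J) (\<Union>i. ?S i)"
  proof (rule finite_measure_UNION)
    show "range ?S \<subseteq> sets (leb_cube J)" using assms by (auto intro!: sets_section)
    show "disjoint_family ?S" using assms(3) by (auto simp: disjoint_family_on_def)
  qed
  moreover have "(\<Union>i. ?S i) = {y \<in> space (leb_cube J). mix H G x y \<in> (\<Union>i. A i)}" by auto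
  ultimately show ?thesis by (simp add: section_measure_def)
qed

lemma section_measure_box:
  assumes J: "finite J" "H \<subseteq> J" and G: "G \<subseteq> H" and A: "borel_box H A" and x: "x \<in> space (leb_cube J)"
  shows "section_measure J H G (PiE H A) x =
    (\<Prod>j\<in>G. indicator (A j) (x j)) * (\<Prod>j\<in>H - G. measure lborel (A j))"
proof (cases "\<forall>j\<in>G. x j \<in> A j")
  case True
  \<comment> \<open>Since \<open>x\<close> meets the constraints on \<open>G\<close>, the section is a box, unconstrained off \<open>H - G\<close>.\<close>
  define B where "B j = (if j \<in> H - G then A j else {0..1})" for j
  have B: "borel_box J B" using A by (auto simp: borel_box_def B_def)
  have "{y \<in> space (leb_cube J). mix H G x y \<in> PiE H A} = PiE J B"
    unfolding space_leb_cube
  proof (intro equalityI subsetI)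
    fix y assume y: "y \<in> {y \<in> \<Pi>\<^sub>E j\<in>J. {0..1}. mix H G x y \<in> PiE H A}"
    then have mixA: "mix H G x y j \<in> A j" if "j \<in> H" for j using that by (auto simp: PiE_iff)
    have "y j \<in> B j" if "j \<in> J" for j
    proof (cases "j \<in> H - G")
      case True
      then show ?thesis using mixA[of j] by (simp add: B_def mix_def)
    next
      case False
      then have "B j = {0..1}" unfolding B_def by (rule if_not_P)
      then show ?thesis using y that by (simp add: PiE_iff)
    qed
    then show "y \<in> PiE J B" using y by (simp add: PiE_iff)
  next
    fix y assume y: "y \<in> PiE J B"
    have yB: "y j \<in> B j" if "j \<in> J" for j using y that by (auto simp: PiE_iff)
    have "y j \<in> {0..1}" if "j \<in> J" for j using yB[OF that] B that unfolding borel_box_def by blast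
    then have "y \<in> (\<Pi>\<^sub>E j\<in>J. {0..1})" using y by (simp add: PiE_iff)
    moreover have "(if j \<in> G then x j else y j) \<in> A j" if "j \<in> H" for j
    proof (cases "j \<in> G")
      case False
      have "j \<in> J" using that J(2) by auto
      from yB[OF this] show ?thesis using False that by (simp add: B_def)
    qed (use True in simp)
    then have "mix H G x y \<in> PiE H A" by (simp add: mix_def PiE_iff)
    ultimately show "y \<in> {y \<in> \<Pi>\<^sub>E j\<in>J. {0..1}. mix H G x y \<in> PiE H A}" by simp
  qed
  then have "section_measure J H G (PiE H A) x = (\<Prod>j\<in>J. measure lborel (B j))"
    unfolding section_measure_def using measure_box[OF J(1) B] by simp
  also have "\<dots> = (\<Prod>j\<in>H - G. measure lborel (A j))"
    using J by (intro prod.mono_neutral_cong_right) (auto simp: B_def)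
  finally show ?thesis using True by simp
next
  case False
  then obtain k where k: "k \<in> G" "x k \<notin> A k" by auto
  have "mix H G x y \<notin> PiE H A" for y
  proof
    assume "mix H G x y \<in> PiE H A"
    then have "mix H G x y k \<in> A k" using k G by (auto simp: PiE_iff)
    then show False using k G by (auto simp: mix_def split: if_split_asm)
  qed
  then have "section_measure J H G (PiE H A) x = 0" by (simp add: section_measure_def)
  moreover have "finite G" using J G by (meson finite_subset)
  then have "(\<Prod>j\<in>G. indicator (A j) (x j)) = (0::real)"
    using k by (intro prod_zero bexI[of _ k]) auto
  ultimately show ?thesis by simp
qed

lemma pillow_fun_box:
  assumes J: "finite J" "H \<subseteq> J" and A: "borel_box H A" and x: "x \<in> space (leb_cube J)"
  shows "pillow_fun J H (PiE H A) x = (\<Prod>j\<in>H. indicator (A j) (x j) - measure lborel (A j))"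
proof -
  have "finite H" using J finite_subset by auto
  then have "(\<Prod>j\<in>H. indicator (A j) (x j) - measure lborel (A j)) =
    (\<Sum>G\<in>Pow H. (-1) ^ (card H - card G) * (\<Prod>j\<in>G. indicator (A j) (x j)) * (\<Prod>j\<in>H - G. measure lborel (A j)))"
    by (rule prod_diff_conv_sum')
  also have "\<dots> = pillow_fun J H (PiE H A) x"
    unfolding pillow_fun_def using section_measure_box[OF J _ A x] by (intro sum.cong refl) (simp add: mult.assoc)
  finally show ?thesis by simp
qed

lemma sq_int_pillow_fun:
  assumes "H \<subseteq> J" "A \<in> sets (unit_cube H)"
  shows "sq_int (leb_cube J) (pillow_fun J H A)"
proof -
  interpret prob_space "leb_cube J" by (rule prob_space_leb_cube)
  have "sq_int (leb_cube J) (\<lambda>x. \<Sum>G\<in>Pow H. (-1) ^ (card H - card G) * section_measure J H G A x)"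
  proof (intro sq_int_sum sq_int_scale)
    show "sq_int (leb_cube J) (section_measure J H G A)" for G
      using measurable_section_measure[OF assms] section_measure_bounds[of J H G A]
      by (intro sq_int_bounded[of _ 1]) auto
  qed
  then show ?thesis unfolding pillow_fun_def[abs_def] .
qed

text \<open>Dominated convergence: each section measure is countably additive in \<open>A\<close> at every point, with
  remainders between \<open>0\<close> and \<open>1\<close>.\<close>

lemma pillow_fun_L2_sums:
  assumes H: "H \<subseteq> J" and A: "range A \<subseteq> sets (unit_cube H)" "disjoint_family A"
  shows "(\<lambda>n::nat. sqnorm (leb_cube J) (\<lambda>x. pillow_fun J H (\<Union>i. A i) x - (\<Sum>i<n. pillow_fun J H (A i) x))) \<longlonglongrightarrow> 0"
proof -
  interpret prob_space "leb_cube J" by (rule prob_space_leb_cube)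
  let ?C = "leb_cube J"
  let ?r = "\<lambda>n x. pillow_fun J H (\<Union>i. A i) x - (\<Sum>i<n. pillow_fun J H (A i) x)"
  let ?d = "\<lambda>n G x. section_measure J H G (\<Union>i. A i) x - (\<Sum>i<n. section_measure J H G (A i) x)"
  have r: "?r n x = (\<Sum>G\<in>Pow H. (-1) ^ (card H - card G) * ?d n G x)" for n x
  proof -
    have "(\<Sum>i<n. pillow_fun J H (A i) x) = (\<Sum>G\<in>Pow H. \<Sum>i<n. (-1) ^ (card H - card G) * section_measure J H G (A i) x)"
      unfolding pillow_fun_def by (rule sum.swap)
    then show ?thesis
      by (simp add: pillow_fun_def right_diff_distrib sum_subtractf sum_distrib_left)
  qed
  have d0: "(\<lambda>n. ?d n G x) \<longlonglongrightarrow> 0" if "x \<in> space ?C" for G x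
  proof -
    have "(\<lambda>n. ?d n G x) \<longlonglongrightarrow> section_measure J H G (\<Union>i. A i) x - section_measure J H G (\<Union>i. A i) x"
      using section_measure_sums[OF H A that, of G] unfolding sums_def by (intro tendsto_intros)
    then show ?thesis by simp
  qed
  have d1: "\<bar>?d n G x\<bar> \<le> 1" if "x \<in> space ?C" for n G x
  proof -
    note S = section_measure_sums[OF H A that, of G]
    have "(\<Sum>i<n. section_measure J H G (A i) x) \<le> (\<Sum>i. section_measure J H G (A i) x)"
      using section_measure_bounds by (intro sum_le_suminf sums_summable[OF S]) auto
    also have "\<dots> = section_measure J H G (\<Union>i. A i) x" by (rule sums_unique[OF S, symmetric])
    finally have "(\<Sum>i<n. section_measure J H G (A i) x) \<le> section_measure J H G (\<Union>i. A i) x" .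
    moreover have "0 \<le> (\<Sum>i<n. section_measure J H G (A i) x)"
      by (intro sum_nonneg section_measure_bounds)
    ultimately show ?thesis using section_measure_bounds(2)[of J H G "\<Union>i. A i" x] by linarith
  qed
  have "(\<lambda>n. LINT x|?C. (?r n x)\<^sup>2) \<longlonglongrightarrow> (LINT x|?C. 0)"
  proof (rule integral_dominated_convergence)
    show "integrable ?C (\<lambda>x. (real (card (Pow H)))\<^sup>2)" by simp
    have "A i \<in> sets (unit_cube H)" for i using A by auto
    then have [measurable]: "pillow_fun J H (A i) \<in> borel_measurable ?C" "pillow_fun J H (\<Union>i. A i) \<in> borel_measurable ?C" for i
      using sq_intD(1)[OF sq_int_pillow_fun[OF H]] by auto
    show "(\<lambda>x. (?r n x)\<^sup>2) \<in> borel_measurable ?C" for n by measurable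
    show "AE x in ?C. (\<lambda>n. (?r n x)\<^sup>2) \<longlonglongrightarrow> 0"
    proof (intro AE_I2)
      fix x assume "x \<in> space ?C"
      then have "(\<lambda>n. (?r n x)\<^sup>2) \<longlonglongrightarrow> (\<Sum>G\<in>Pow H. (-1) ^ (card H - card G) * 0)\<^sup>2"
        unfolding r by (intro tendsto_intros d0)
      then show "(\<lambda>n. (?r n x)\<^sup>2) \<longlonglongrightarrow> 0" by simp
    qed
    show "AE x in ?C. norm ((?r n x)\<^sup>2) \<le> (real (card (Pow H)))\<^sup>2" for n
    proof (intro AE_I2)
      fix x assume x: "x \<in> space ?C"
      have "\<bar>?r n x\<bar> \<le> (\<Sum>G\<in>Pow H. \<bar>(-1) ^ (card H - card G) * ?d n G x\<bar>)"
        unfolding r by (rule sum_abs)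
      also have "\<dots> \<le> (\<Sum>G\<in>Pow H. 1)"
        using d1[OF x] by (intro sum_mono) (simp add: abs_mult)
      finally have "\<bar>?r n x\<bar> \<le> real (card (Pow H))" by simp
      then have "\<bar>?r n x\<bar>\<^sup>2 \<le> (real (card (Pow H)))\<^sup>2" by (intro power_mono) auto
      then show "norm ((?r n x)\<^sup>2) \<le> (real (card (Pow H)))\<^sup>2" by simp
    qed
  qed simp
  then show ?thesis by simp
qed

lemma pillow_fun_inner_sums:
  assumes "H \<subseteq> J" "range A \<subseteq> sets (unit_cube H)" "disjoint_family A" "sq_int (leb_cube J) g"
  shows "(\<lambda>i::nat. inner_L2 (leb_cube J) (pillow_fun J H (A i)) g) sums inner_L2 (leb_cube J) (pillow_fun J H (\<Union>i. A i)) g"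
proof (rule inner_L2_sums[OF _ _ assms(4) pillow_fun_L2_sums[OF assms(1-3)]])
  show "sq_int (leb_cube J) (pillow_fun J H (A i))" for i using assms by (intro sq_int_pillow_fun) auto
  show "sq_int (leb_cube J) (pillow_fun J H (\<Union>i. A i))"
    using assms by (intro sq_int_pillow_fun sets.countable_UN) auto
qed

text \<open>On boxes both integrands are products over coordinates, so the inner product factorizes.  A
  coordinate in exactly one of \<open>H\<close> and \<open>G\<close> contributes the mean \<open>0\<close> of a centred indicator.\<close>

lemma pillow_fun_inner_box:
  assumes J: "finite J" "H \<subseteq> J" "G \<subseteq> J" and A: "borel_box H A" and B: "borel_box G B"
  shows "inner_L2 (leb_cube J) (pillow_fun J H (PiE H A)) (pillow_fun J G (PiE G B)) =
    (if H = G then \<Prod>j\<in>H. measure lborel (A j \<inter> B j) - measure lborel (A j) * measure lborel (B j) else 0)"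
proof -
  interpret U: prob_space unit_lborel by (rule prob_space_unit_lborel)
  interpret product_sigma_finite "\<lambda>_. unit_lborel" by unfold_locales
  define a where "a j t = (if j \<in> H then indicator (A j) t - measure lborel (A j) else 1)" for j t
  define b where "b j t = (if j \<in> G then indicator (B j) t - measure lborel (B j) else 1)" for j t
  let ?c = "\<lambda>j. measure lborel (A j \<inter> B j) - measure lborel (A j) * measure lborel (B j)"
  have extend: "(\<Prod>j\<in>K. u j) = (\<Prod>j\<in>J. if j \<in> K then u j else 1)" if "K \<subseteq> J" for K and u :: "'a \<Rightarrow> real"
    using that J(1) by (intro prod.mono_neutral_cong_left) auto
  have ind: "(indicator X :: real \<Rightarrow> real) \<in> borel_measurable unit_lborel" "integrable unit_lborel (indicator X :: real \<Rightarrow> real)"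
    "(LINT t|unit_lborel. indicator X t) = measure lborel X" if "X \<in> sets borel" "X \<subseteq> {0..1}" for X
  proof -
    have X: "X \<in> sets unit_lborel" using that sets_unit_lborel_iff by blast
    have X01: "X \<inter> {0..1} = X" using that(2) by auto
    show "(indicator X :: real \<Rightarrow> real) \<in> borel_measurable unit_lborel" using X by simp
    show "integrable unit_lborel (indicator X :: real \<Rightarrow> real)" using X by (simp add: integrable_indicator_iff U.emeasure_eq_measure space_restrict_space X01)
    show "(LINT t|unit_lborel. indicator X t) = measure lborel X"
      using X that measure_unit_lborel[of X] by (simp add: space_restrict_space X01)
  qed
  have A': "A j \<in> sets borel" "A j \<subseteq> {0..1}" if "j \<in> H" for j using A that by (auto simp: borel_box_def)
  have B': "B j \<in> sets borel" "B j \<subseteq> {0..1}" if "j \<in> G" for j using B that by (auto simp: borel_box_def)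
  have one: "(LINT t|unit_lborel. indicator X t - measure lborel X) = 0"
    if "X \<in> sets borel" "X \<subseteq> {0..1}" for X
    using ind[OF that] U.prob_space by (subst Bochner_Integration.integral_diff) auto
  have meas: "a j \<in> borel_measurable unit_lborel" "b j \<in> borel_measurable unit_lborel" for j
    using ind(1)[OF A', of j] ind(1)[OF B', of j] unfolding a_def[abs_def] b_def[abs_def]
    by (cases "j \<in> H"; cases "j \<in> G"; simp)+
  have bound: "\<bar>a j t\<bar> \<le> 1 + \<bar>measure lborel (A j)\<bar>" "\<bar>b j t\<bar> \<le> 1 + \<bar>measure lborel (B j)\<bar>" for j t
    using abs_triangle_ineq4[of 1 "measure lborel (A j)"] abs_triangle_ineq4[of 1 "measure lborel (B j)"]
    by (auto simp: a_def b_def indicator_def)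
  have sq: "sq_int unit_lborel (a j)" "sq_int unit_lborel (b j)" for j
    using U.sq_int_bounded[OF meas(1) bound(1)] U.sq_int_bounded[OF meas(2) bound(2)] by auto
  have factor: "(LINT t|unit_lborel. a j t * b j t) =
      (if j \<in> H \<inter> G then ?c j else if j \<in> H \<union> G then 0 else 1)" for j
  proof (cases "j \<in> H"; cases "j \<in> G")
    assume j: "j \<in> H" "j \<in> G"
    have AB: "A j \<inter> B j \<in> sets borel" "A j \<inter> B j \<subseteq> {0..1}" using A'[OF j(1)] B'[OF j(2)] by auto
    have "a j t * b j t = (indicator (A j \<inter> B j) t - measure lborel (A j) * indicator (B j) t)
        - measure lborel (B j) * (indicator (A j) t - measure lborel (A j))" for t
      using j by (simp add: a_def b_def indicator_inter_arith algebra_simps)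
    then have "(LINT t|unit_lborel. a j t * b j t) =
      (LINT t|unit_lborel. indicator (A j \<inter> B j) t - measure lborel (A j) * indicator (B j) t)
        - (LINT t|unit_lborel. measure lborel (B j) * (indicator (A j) t - measure lborel (A j)))"
      using ind(2)[OF AB] ind(2)[OF A'[OF j(1)]] ind(2)[OF B'[OF j(2)]]
      by (simp only:) (intro Bochner_Integration.integral_diff Bochner_Integration.integrable_diff
          integrable_mult_right U.integrable_const)
    also have "\<dots> = ?c j"
      using ind(2,3)[OF AB] ind(2,3)[OF B'[OF j(2)]] one[OF A'[OF j(1)]] by simp
    finally show ?thesis using j by simp
  qed (use one[OF A'] one[OF B'] U.prob_space in \<open>auto simp: a_def b_def space_restrict_space\<close>)
  have "inner_L2 (leb_cube J) (pillow_fun J H (PiE H A)) (pillow_fun J G (PiE G B))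
      = (LINT x|leb_cube J. (\<Prod>j\<in>J. a j (x j) * b j (x j)))"
  proof (intro Bochner_Integration.integral_cong refl)
    fix x assume x: "x \<in> space (leb_cube J)"
    show "pillow_fun J H (PiE H A) x * pillow_fun J G (PiE G B) x = (\<Prod>j\<in>J. a j (x j) * b j (x j))"
      unfolding pillow_fun_box[OF J(1,2) A x] pillow_fun_box[OF J(1,3) B x] extend[OF J(2)] extend[OF J(3)]
        a_def b_def prod.distrib ..
  qed
  also have "\<dots> = (\<Prod>j\<in>J. LINT t|unit_lborel. a j t * b j t)"
    unfolding leb_cube_def using sq_int_mult[OF sq] by (intro product_integral_prod J(1))
  also have "\<dots> = (if H = G then \<Prod>j\<in>H. ?c j else 0)"
  proof (cases "H = G")
    case True
    then show ?thesis unfolding factor extend[OF J(2)] by (auto intro!: prod.cong)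
  next
    case False
    then obtain j where "j \<in> J" "j \<in> H \<union> G" "j \<notin> H \<inter> G" using J by blast
    then show ?thesis unfolding factor using False J(1) by (auto intro!: prod_zero bexI[of _ j])
  qed
  finally show ?thesis .
qed

lemma pillow_fun_orthogonal:
  assumes J: "finite J" "H \<subseteq> J" "G \<subseteq> J" "H \<noteq> G" and A: "A \<in> sets (unit_cube H)" and B: "B \<in> sets (unit_cube G)"
  shows "inner_L2 (leb_cube J) (pillow_fun J H A) (pillow_fun J G B) = 0"
proof -
  \<comment> \<open>The \<open>\<pi>\<close>-\<open>\<lambda>\<close> argument is applied to one set at a time.\<close>
  have half: "inner_L2 (leb_cube J) (pillow_fun J H A) (pillow_fun J G (PiE G X)) = 0" if X: "borel_box G X" for X
  proof (rule additive_zero_if_zero_on_boxes[OF _ _ A])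
    have "PiE G X \<in> sets (unit_cube G)" using X J finite_subset by (intro sets_box) auto
    then show "(\<lambda>i::nat. inner_L2 (leb_cube J) (pillow_fun J H (E i)) (pillow_fun J G (PiE G X))) sums
        inner_L2 (leb_cube J) (pillow_fun J H (\<Union>i. E i)) (pillow_fun J G (PiE G X))"
      if "range E \<subseteq> sets (unit_cube H)" "disjoint_family E" for E
      by (intro pillow_fun_inner_sums sq_int_pillow_fun J that)
    show "inner_L2 (leb_cube J) (pillow_fun J H (PiE H Y)) (pillow_fun J G (PiE G X)) = 0" if "borel_box H Y" for Y
      using pillow_fun_inner_box[OF J(1-3) that X] J(4) by simp
  qed
  have "inner_L2 (leb_cube J) (pillow_fun J G B) (pillow_fun J H A) = 0"
  proof (rule additive_zero_if_zero_on_boxes[OF _ _ B])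
    show "(\<lambda>i::nat. inner_L2 (leb_cube J) (pillow_fun J G (E i)) (pillow_fun J H A)) sums
        inner_L2 (leb_cube J) (pillow_fun J G (\<Union>i. E i)) (pillow_fun J H A)"
      if "range E \<subseteq> sets (unit_cube G)" "disjoint_family E" for E
      by (intro pillow_fun_inner_sums sq_int_pillow_fun J that A)
    show "inner_L2 (leb_cube J) (pillow_fun J G (PiE G X)) (pillow_fun J H A) = 0" if "borel_box G X" for X
      using half[OF that] by (simp add: mult.commute)
  qed
  then show ?thesis by (simp add: mult.commute)
qed

lemma indicator_box_decomposition:
  assumes J: "finite J" and A: "borel_box J A" and x: "x \<in> space (leb_cube J)"
  shows "indicator (PiE J A) x = (\<Sum>H\<in>Pow J. (\<Prod>j\<in>J - H. measure lborel (A j)) * pillow_fun J H (PiE H A) x)"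
proof -
  have "indicator (PiE J A) x = (\<Prod>j\<in>J. indicator (A j) (x j) :: real)"
  proof (cases "x \<in> PiE J A")
    case True then show ?thesis by (auto simp: PiE_iff)
  next
    case False
    then obtain j where "j \<in> J" "x j \<notin> A j" using x by (auto simp: space_leb_cube PiE_iff)
    then show ?thesis using False J by (auto intro!: prod_zero[symmetric] bexI[of _ j])
  qed
  also have "\<dots> = (\<Prod>j\<in>J. (indicator (A j) (x j) - measure lborel (A j)) + measure lborel (A j))" by simp
  also have "\<dots> = (\<Sum>H\<in>Pow J. (\<Prod>j\<in>H. indicator (A j) (x j) - measure lborel (A j)) * (\<Prod>j\<in>J - H. measure lborel (A j)))"
    by (rule prod_add[OF J])
  also have "\<dots> = (\<Sum>H\<in>Pow J. (\<Prod>j\<in>J - H. measure lborel (A j)) * pillow_fun J H (PiE H A) x)"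
  proof (intro sum.cong refl)
    fix H assume "H \<in> Pow J"
    then have "H \<subseteq> J" "borel_box H A" using A by (auto simp: borel_box_def)
    then show "(\<Prod>j\<in>H. indicator (A j) (x j) - measure lborel (A j)) * (\<Prod>j\<in>J - H. measure lborel (A j)) =
        (\<Prod>j\<in>J - H. measure lborel (A j)) * pillow_fun J H (PiE H A) x"
      using pillow_fun_box[OF J _ _ x] by (simp add: mult.commute)
  qed
  finally show ?thesis .
qed

section \<open>Brownian pillows\<close>

theorem theorem2:
  fixes M :: "'w measure" and p :: nat
    and W :: "(nat \<Rightarrow> real) set \<Rightarrow> 'w \<Rightarrow> real"
  assumes "prob_space M" and "p \<ge> 1" and "wiener_measure M p W"
  shows "\<exists>b :: nat set \<Rightarrow> (nat \<Rightarrow> real) set \<Rightarrow> 'w \<Rightarrow> real.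
    (\<forall>H. H \<subseteq> {1..p} \<longrightarrow> zm_measure M H (b H)) \<and>
    indep_measures M (Pow {1..p}) b \<and>
    (\<forall>A. borel_box {1..p} A \<longrightarrow>
      (AE \<omega> in M. W (PiE {1..p} A) \<omega> =
        (\<Sum>H\<in>Pow {1..p}. (\<Prod>j\<in>{1..p} - H. measure lborel (A j)) * b H (PiE H A) \<omega>))) \<and>
    (\<forall>H A B. H \<subseteq> {1..p} \<and> borel_box H A \<and> borel_box H B \<longrightarrow>
      (LINT \<omega>|M. b H (PiE H A) \<omega> * b H (PiE H B) \<omega>) =
        (\<Prod>j\<in>H. measure lborel (A j \<inter> B j) - measure lborel (A j) * measure lborel (B j)))"
proof -
  let ?J = "{1..p}"
  interpret white_noise M "leb_cube ?J" W by (rule wiener_white_noise[OF assms(1,3)])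
  \<comment> \<open>Any version of the integral will do; versions differ on null sets only.\<close>
  define b where "b H A = (SOME X. wiener_integral (pillow_fun ?J H A) X)" for H A
  have b: "wiener_integral (pillow_fun ?J H A) (b H A)" if "H \<subseteq> ?J" "A \<in> sets (unit_cube H)" for H A
    unfolding b_def by (rule someI_ex[OF wiener_integral_exists[OF sq_int_pillow_fun[OF that]]])
  have box: "PiE H A \<in> sets (unit_cube H)" if "H \<subseteq> ?J" "borel_box H A" for H A
    using that finite_subset by (intro sets_box) auto
  have gaussian: "gaussian_measure M H (b H)" if H: "H \<subseteq> ?J" for H
    unfolding gaussian_measure_def jointly_centred_gaussian_def
  proof (intro conjI allI impI)
    fix F and c :: "(nat \<Rightarrow> real) set \<Rightarrow> real" assume "finite F \<and> F \<subseteq> sets (unit_cube H)"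
    then have "wiener_integral (\<lambda>x. \<Sum>A\<in>F. c A * pillow_fun ?J H A x) (\<lambda>\<omega>. \<Sum>A\<in>F. c A * b H A \<omega>)"
      by (intro wiener_integral_sum b H) auto
    then show "centred_gaussian M (\<lambda>\<omega>. \<Sum>A\<in>F. c A * b H A \<omega>)" by (rule wiener_integral_gaussian)
  next
    fix A :: "nat \<Rightarrow> (nat \<Rightarrow> real) set"
    assume A: "range A \<subseteq> sets (unit_cube H) \<and> disjoint_family A"
    have "wiener_integral (\<lambda>x. pillow_fun ?J H (\<Union>i. A i) x + (-1) * (\<Sum>i<n. 1 * pillow_fun ?J H (A i) x))
        (\<lambda>\<omega>. b H (\<Union>i. A i) \<omega> + (-1) * (\<Sum>i<n. 1 * b H (A i) \<omega>))" for n
      using A H by (intro wiener_integral_lin wiener_integral_sum b sets.countable_UN) auto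
    from wiener_integral_isometry[OF this]
    show "(\<lambda>n. LINT \<omega>|M. (b H (\<Union>i. A i) \<omega> - (\<Sum>i<n::nat. b H (A i) \<omega>))\<^sup>2) \<longlonglongrightarrow> 0"
      using pillow_fun_L2_sums[OF H, of A] A by simp
  qed
  have "zm_measure M H (b H)" if H: "H \<subseteq> ?J" for H
    unfolding zm_measure_def
  proof (intro conjI allI impI gaussian H)
    fix A assume "borel_box H A \<and> (\<exists>j\<in>H. A j = {0..1})"
    then obtain k where A: "borel_box H A" and k: "k \<in> H" "A k = {0..1}" by auto
    have "pillow_fun ?J H (PiE H A) x = 0" if x: "x \<in> space (leb_cube ?J)" for x
    proof -
      have "x k \<in> {0..1}" using x k H unfolding space_leb_cube by (auto simp: PiE_iff)
      then show ?thesis unfolding pillow_fun_box[OF finite_atLeastAtMost H A x]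
        using k H finite_subset[OF H] by (intro prod_zero bexI[of _ k]) auto
    qed
    then show "AE \<omega> in M. b H (PiE H A) \<omega> = 0"
      by (rule wiener_integral_unique[OF b[OF H box[OF H A]] wiener_integral_zero])
  qed
  moreover have "indep_measures M (Pow ?J) b"
  proof -
    interpret G: gaussian_space M "{X. \<exists>f. wiener_integral f X}" by (rule gaussian_space_wiener_integrals)
    show ?thesis unfolding indep_measures_def
    proof (rule G.orthogonal_families_indep)
      show "b H A \<in> {X. \<exists>f. wiener_integral f X}" if "H \<in> Pow ?J" "A \<in> sets (unit_cube H)" for H A
        using b that by blast
      show "inner_L2 M (b H A) (b G B) = 0"
        if "H \<in> Pow ?J" "G \<in> Pow ?J" "H \<noteq> G" "A \<in> sets (unit_cube H)" "B \<in> sets (unit_cube G)" for H G A B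
        using that pillow_fun_orthogonal[of ?J H G A B] by (simp add: wiener_integral_inner[OF b b])
    qed
  qed
  moreover have "AE \<omega> in M. W (PiE ?J A) \<omega> =
      (\<Sum>H\<in>Pow ?J. (\<Prod>j\<in>?J - H. measure lborel (A j)) * b H (PiE H A) \<omega>)" if A: "borel_box ?J A" for A
  proof (rule wiener_integral_unique)
    show "wiener_integral (indicator (PiE ?J A)) (W (PiE ?J A))"
      using box[OF _ A] by (intro wiener_integral_indicator) (simp add: sets_leb_cube)
    show "wiener_integral (\<lambda>x. \<Sum>H\<in>Pow ?J. (\<Prod>j\<in>?J - H. measure lborel (A j)) * pillow_fun ?J H (PiE H A) x)
        (\<lambda>\<omega>. \<Sum>H\<in>Pow ?J. (\<Prod>j\<in>?J - H. measure lborel (A j)) * b H (PiE H A) \<omega>)"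
      using A by (intro wiener_integral_sum b box) (auto simp: borel_box_def)
  qed (rule indicator_box_decomposition[OF _ A]; simp)
  moreover have "(LINT \<omega>|M. b H (PiE H A) \<omega> * b H (PiE H B) \<omega>) =
        (\<Prod>j\<in>H. measure lborel (A j \<inter> B j) - measure lborel (A j) * measure lborel (B j))"
    if "H \<subseteq> ?J" "borel_box H A" "borel_box H B" for H A B
    using that pillow_fun_inner_box[of ?J H H A B]
    by (simp add: wiener_integral_inner[OF b b] box)
  ultimately show ?thesis by (intro exI[of _ b]) blast
qed

end
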